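(* Let $r>3$ be a real number that is not an integer. Then there is a hereditary class $\mathcal{H}$ of directed graphs with graph relation $R$ that is closed under weak embeddings, such that: (a) the graph $\{a_i\}_{i<\omega}$, where $a_i R a_j$ exactly when $i<j$, belongs to $\mathcal{H}$; (b) the graph $\{a_\theta\}_{\theta\in S^1}$, where $a_\theta R a_\psi$ exactly when $\psi\ne\theta$ lies at most $\frac{2\pi}{r}$ radians counterclockwise from $\theta$, does not belong to $\mathcal{H}$; and (c) $\mathcal{H}$ is closed under $n$-interval helix maps for every integer $n>r$.
   Context: Graphs are directed graphs (without loops) with edge relation $R$. A hereditary class of directed graphs is a class of finite directed graphs, considered up to isomorphism, closed under induced subgraphs; for an infinite directed graph $M$, $M\in\mathcal{H}$ means every finite induced subgraph of $M$ belongs to $\mathcal{H}$. A weak embedding is a one-to-one map $\iota:A\hookrightarrow B$ such that $aRb$ implies $\iota(a)R\iota(b)$. $\mathcal{H}$ is closed under weak embeddings if $B\in\mathcal{H}$ and a weak embedding $A\hookrightarrow B$ imply $A\in\mathcal{H}$. $S^1$ is the unit circle. Let $n\ge 3$ be an integer. A cyclic $n$-decomposition of a finite directed graph $G$ is a partition $G=\bigsqcup_{i=0}^{n-1}G_i\sqcup D$ (parts may be empty) such that every edge of $G$ has both endpoints in some fixed set of the form $G_i\cup G_{i+1 \bmod n}\cup D$. It is directed if any edge between $v\in G_i$ and $v'\in G_{i+1\bmod n}$ is in the direction from $v$ to $v'$. Helix map: given a cyclic $n$-decomposition $G=\bigsqcup_{i=0}^{n-1}G_i\sqcup D$, let $H$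 be the directed graph whose vertices are those of $D$ together with pairwise disjoint copies $G_i^j$ of the vertex set of $G_i$ for each $i<n$, $j<\omega$, with the unique edge relation such that (1) for $j<j'$ and $i'=i+1\bmod n$, the natural map from $G_i^j\sqcup G_{i'}^{j'}\sqcup D$ to $G_i\sqcup G_{i'}\sqcup D$ (sending each copy of a vertex to that vertex, and being the identity on $D$) is an isomorphism of induced subgraphs; and (2) there are no edges of $H$ whose endpoints are not both in some fixed set of the form $G_i^j\sqcup G_{i'}^{j'}\sqcup D$ with $j<j'$, $i'=i+1\bmod n$. The $n$-helix map associated with the decomposition is the natural map $h:H\twoheadrightarrow G$. It is an $n$-interval helix map if the decomposition is directed and each $G_i$ is a disjoint union $\bigsqcup_{j<n_i}S_i^j$ of sets linearly ordered by $R$, with no edges in either direction between vertices of $S_i^j$ and $S_i^{j'}$ for $j\ne j'$. $\mathcal{H}$ is closed under $n$-interval helix maps if whenever $h:H\twoheadrightarrow G$ is an $n$-interval helix map and $H\in\mathcal{H}$, then $G\in\mathcal{H}$. *)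

theory Defs
  imports
    "HOL-Analysis.Analysis"
    "Graph_Theory.Pair_Digraph"
    "Graph_Theory.Digraph_Isomorphism"
begin

text \<open>
  A directed graph with edge relation \<open>R\<close> is a \<open>pair_pre_digraph\<close> whose arc set is \<open>R\<close>.
  Directed graphs without loops, possibly infinite, are those satisfying
  \<open>pair_loopfree_digraph\<close>; the finite ones are those satisfying \<open>pair_digraph\<close>.
  An edge relation may contain both \<open>(u, v)\<close> and \<open>(v, u)\<close>.

  The library's \<open>digraph_iso\<close> and \<open>induced_subgraph\<close> are used through the coercion
  \<open>with_proj\<close> from \<open>pair_pre_digraph\<close> to \<open>pre_digraph\<close>.
\<close>

definition weak_embedding ::
  "('a \<Rightarrow> 'b) \<Rightarrow> 'a pair_pre_digraph \<Rightarrow> 'b pair_pre_digraph \<Rightarrow> bool" where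
  "weak_embedding f A B \<longleftrightarrow>
     f ` pverts A \<subseteq> pverts B \<and> inj_on f (pverts A) \<and>
     (\<forall>(a, b) \<in> parcs A. (f a, f b) \<in> parcs B)"

text \<open>
  A class of finite directed graphs up to isomorphism is represented by an isomorphism-closed
  set of finite directed graphs with vertices in \<open>nat\<close>; every isomorphism type of finite graphs
  has such representatives.
\<close>

definition hereditary_class :: "nat pair_pre_digraph set \<Rightarrow> bool" where
  "hereditary_class \<H> \<longleftrightarrow>
     (\<forall>A \<in> \<H>. pair_digraph A) \<and>
     (\<forall>A \<in> \<H>. \<forall>B :: nat pair_pre_digraph.
        digraph_iso (with_proj A) (with_proj B) \<longrightarrow> B \<in> \<H>) \<and>
     (\<forall>A \<in> \<H>. \<forall>B :: nat pair_pre_digraph.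
        induced_subgraph (with_proj B) (with_proj A) \<longrightarrow> B \<in> \<H>)"

text \<open>
  Membership of an arbitrary (possibly infinite) directed graph, on any type of vertices.
\<close>

definition belongs_to :: "'a pair_pre_digraph \<Rightarrow> nat pair_pre_digraph set \<Rightarrow> bool" where
  "belongs_to M \<H> \<longleftrightarrow>
     (\<forall>A :: 'a pair_pre_digraph.
        induced_subgraph (with_proj A) (with_proj M) \<and> finite (pverts A) \<longrightarrow>
        (\<exists>B \<in> \<H>. digraph_iso (with_proj A) (with_proj B)))"

definition closed_under_weak_embeddings :: "nat pair_pre_digraph set \<Rightarrow> bool" where
  "closed_under_weak_embeddings \<H> \<longleftrightarrow>
     (\<forall>B \<in> \<H>. \<forall>A :: nat pair_pre_digraph. \<forall>f.
        pair_digraph A \<and> weak_embedding f A B \<longrightarrow> A \<in> \<H>)"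

definition cyclic_decomposition ::
  "nat \<Rightarrow> 'a pair_pre_digraph \<Rightarrow> (nat \<Rightarrow> 'a set) \<Rightarrow> 'a set \<Rightarrow> bool" where
  "cyclic_decomposition n G P D \<longleftrightarrow>
     3 \<le> n \<and> pair_digraph G \<and>
     pverts G = (\<Union>i<n. P i) \<union> D \<and>
     disjoint_family_on P {..<n} \<and> (\<forall>i<n. P i \<inter> D = {}) \<and>
     (\<forall>(u, v) \<in> parcs G. \<exists>i<n. {u, v} \<subseteq> P i \<union> P ((i + 1) mod n) \<union> D)"

definition directed_decomposition ::
  "nat \<Rightarrow> 'a pair_pre_digraph \<Rightarrow> (nat \<Rightarrow> 'a set) \<Rightarrow> bool" where
  "directed_decomposition n G P \<longleftrightarrow>
     (\<forall>i<n. \<forall>v \<in> P i. \<forall>v' \<in> P ((i + 1) mod n). (v', v) \<notin> parcs G)"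

text \<open>
  \<open>strict_linear_order_on\<close> demands transitivity of the whole relation, so \<open>R\<close> has to be
  restricted to the part first.
\<close>

definition interval_parts ::
  "nat \<Rightarrow> 'a pair_pre_digraph \<Rightarrow> (nat \<Rightarrow> 'a set) \<Rightarrow> bool" where
  "interval_parts n G P \<longleftrightarrow>
     (\<forall>i<n. \<exists>(m :: nat) (S :: nat \<Rightarrow> 'a set).
        P i = (\<Union>j<m. S j) \<and> disjoint_family_on S {..<m} \<and>
        (\<forall>j<m. strict_linear_order_on (S j) (Restr (parcs G) (S j))) \<and>
        (\<forall>j<m. \<forall>j'<m. j \<noteq> j' \<longrightarrow> parcs G \<inter> S j \<times> S j' = {}))"

text \<open>
  Vertices of a helix: \<open>Base v\<close> is a vertex of \<open>D\<close>, and \<open>Copy j v\<close> is the copy of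
  \<open>v \<in> P i\<close> lying in the \<open>j\<close>-th copy of \<open>P i\<close>.
\<close>

datatype 'a helix_vertex = Base 'a | Copy nat 'a

primrec helix_proj :: "'a helix_vertex \<Rightarrow> 'a" where
  "helix_proj (Base v) = v"
| "helix_proj (Copy j v) = v"

definition helix_segment ::
  "nat \<Rightarrow> (nat \<Rightarrow> 'a set) \<Rightarrow> 'a set \<Rightarrow> nat \<Rightarrow> nat \<Rightarrow> nat \<Rightarrow> 'a helix_vertex set" where
  "helix_segment n P D i j j' = Copy j ` P i \<union> Copy j' ` P ((i + 1) mod n) \<union> Base ` D"

text \<open>\<open>h\<close> is, as a map on vertices, an isomorphism of \<open>G\<close> onto \<open>H\<close>.\<close>

definition iso_by :: "('a \<Rightarrow> 'c) \<Rightarrow> ('a, 'b) pre_digraph \<Rightarrow> ('c, 'd) pre_digraph \<Rightarrow> bool" where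
  "iso_by h G H \<longleftrightarrow>
     (\<exists>f. iso_verts f = h \<and> pre_digraph.digraph_isomorphism G f \<and> H = app_iso f G)"

definition is_helix ::
  "nat \<Rightarrow> 'a pair_pre_digraph \<Rightarrow> (nat \<Rightarrow> 'a set) \<Rightarrow> 'a set \<Rightarrow>
   'a helix_vertex pair_pre_digraph \<Rightarrow> bool" where
  "is_helix n G P D H \<longleftrightarrow>
     pair_loopfree_digraph H \<and>
     pverts H = (\<Union>i<n. \<Union>j. Copy j ` P i) \<union> Base ` D \<and>
     (\<forall>i<n. \<forall>j j'. j < j' \<longrightarrow>
        iso_by helix_proj
          (with_proj H \<restriction> helix_segment n P D i j j')
          (with_proj G \<restriction> (P i \<union> P ((i + 1) mod n) \<union> D))) \<and>
     (\<forall>(x, y) \<in> parcs H. \<exists>i<n. \<exists>j j'. j < j' \<and> {x, y} \<subseteq> helix_segment n P D i j j')"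

definition interval_helix_map ::
  "nat \<Rightarrow> ('a helix_vertex \<Rightarrow> 'a) \<Rightarrow> 'a helix_vertex pair_pre_digraph \<Rightarrow>
   'a pair_pre_digraph \<Rightarrow> bool" where
  "interval_helix_map n h H G \<longleftrightarrow>
     (\<exists>P D. cyclic_decomposition n G P D \<and> directed_decomposition n G P \<and>
            interval_parts n G P \<and> is_helix n G P D H \<and> h = helix_proj)"

definition closed_under_interval_helix_maps :: "nat \<Rightarrow> nat pair_pre_digraph set \<Rightarrow> bool" where
  "closed_under_interval_helix_maps n \<H> \<longleftrightarrow>
     (\<forall>(G :: nat pair_pre_digraph) H h.
        interval_helix_map n h H G \<and> belongs_to H \<H> \<longrightarrow> G \<in> \<H>)"

definition omega_graph :: "nat pair_pre_digraph" where
  "omega_graph = \<lparr>pverts = UNIV, parcs = {(i, j). i < j}\<rparr>"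

text \<open>
  The unit circle is the unit sphere of the complex plane; \<open>z * cis t\<close> is the point lying
  \<open>t\<close> radians counterclockwise from \<open>z\<close>.
\<close>

definition circle_graph :: "real \<Rightarrow> complex pair_pre_digraph" where
  "circle_graph r =
     \<lparr>pverts = sphere 0 1,
      parcs = {(z, w). z \<in> sphere 0 1 \<and> w \<in> sphere 0 1 \<and> w \<noteq> z \<and>
                       (\<exists>t. 0 \<le> t \<and> t \<le> 2 * pi / r \<and> w = z * cis t)}\<rparr>"

lemma loopfree_omega_graph: "pair_loopfree_digraph omega_graph"
  by unfold_locales (auto simp: omega_graph_def)

lemma loopfree_circle_graph: "pair_loopfree_digraph (circle_graph r)"
  by unfold_locales (auto simp: circle_graph_def)

lemma iso_by_pair_iff:
  fixes A :: "'a pair_pre_digraph" and B :: "'b pair_pre_digraph"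
  assumes "pair_wf_digraph A" "pair_wf_digraph B"
  shows "iso_by h (with_proj A \<restriction> U) (with_proj B \<restriction> W) \<longleftrightarrow>
         bij_betw h U W \<and>
         (\<forall>u \<in> U. \<forall>v \<in> U. (u, v) \<in> parcs A \<longleftrightarrow> (h u, h v) \<in> parcs B)"
proof
  assume "iso_by h (with_proj A \<restriction> U) (with_proj B \<restriction> W)"
  then obtain f where f: "iso_verts f = h"
      "pre_digraph.digraph_isomorphism (with_proj A \<restriction> U) f"
      "with_proj B \<restriction> W = app_iso f (with_proj A \<restriction> U)"
    unfolding iso_by_def by blast
  have V: "W = h ` U" using arg_cong[OF f(3), of verts] f(1) by simp
  have T: "iso_tail f = fst" "iso_head f = snd"
    using arg_cong[OF f(3), of tail] arg_cong[OF f(3), of head] by (simp_all)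
  have E: "{e \<in> parcs B. fst e \<in> W \<and> snd e \<in> W} =
      iso_arcs f ` {e \<in> parcs A. fst e \<in> U \<and> snd e \<in> U}"
    using arg_cong[OF f(3), of arcs] by simp
  have I: "inj_on h U" and M: "\<And>e. e \<in> parcs A \<Longrightarrow> fst e \<in> U \<Longrightarrow> snd e \<in> U \<Longrightarrow>
      iso_arcs f e = (h (fst e), h (snd e))"
    using f(2) unfolding pre_digraph.digraph_isomorphism_def
    by (auto simp: f(1) T prod_eq_iff)
  have "(u, v) \<in> parcs A \<longleftrightarrow> (h u, h v) \<in> parcs B" if "u \<in> U" "v \<in> U" for u v
  proof
    assume "(u, v) \<in> parcs A"
    then have "iso_arcs f (u, v) \<in> {e \<in> parcs B. fst e \<in> W \<and> snd e \<in> W}"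
      unfolding E using that by auto
    then show "(h u, h v) \<in> parcs B" using M \<open>(u, v) \<in> parcs A\<close> that by auto
  next
    assume "(h u, h v) \<in> parcs B"
    then have "(h u, h v) \<in> iso_arcs f ` {e \<in> parcs A. fst e \<in> U \<and> snd e \<in> U}"
      unfolding E[symmetric] using that V by auto
    then obtain e where e: "e \<in> parcs A" "fst e \<in> U" "snd e \<in> U" "(h u, h v) = iso_arcs f e"
      by blast
    then have "h u = h (fst e)" "h v = h (snd e)" using M by auto
    then have "u = fst e" "v = snd e"
      using inj_onD[OF I, of u "fst e"] inj_onD[OF I, of v "snd e"] e(2,3) that by auto
    then have "e = (u, v)" by simp
    then show "(u, v) \<in> parcs A" using e by simp
  qed
  then show "bij_betw h U W \<and>
      (\<forall>u \<in> U. \<forall>v \<in> U. (u, v) \<in> parcs A \<longleftrightarrow> (h u, h v) \<in> parcs B)"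
    using I V by (auto simp: bij_betw_def)
next
  assume R: "bij_betw h U W \<and>
      (\<forall>u \<in> U. \<forall>v \<in> U. (u, v) \<in> parcs A \<longleftrightarrow> (h u, h v) \<in> parcs B)"
  let ?f = "\<lparr>iso_verts = h, iso_arcs = map_prod h h, iso_head = snd, iso_tail = fst\<rparr>"
  interpret A: pair_wf_digraph A by fact
  have wf: "wf_digraph (with_proj A \<restriction> U)" by unfold_locales auto
  have I: "inj_on h U" and V: "W = h ` U" using R by (auto simp: bij_betw_def)
  have "pre_digraph.digraph_isomorphism (with_proj A \<restriction> U) ?f"
    unfolding pre_digraph.digraph_isomorphism_def using wf I
    by (auto simp: inj_on_def)
  moreover have "{e \<in> parcs B. fst e \<in> W \<and> snd e \<in> W} =
      map_prod h h ` {e \<in> parcs A. fst e \<in> U \<and> snd e \<in> U}"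
    using R V by (auto simp: image_iff) force
  then have "with_proj B \<restriction> W = app_iso ?f (with_proj A \<restriction> U)"
    using V by (intro pre_digraph.equality) auto
  ultimately show "iso_by h (with_proj A \<restriction> U) (with_proj B \<restriction> W)"
    unfolding iso_by_def by (intro exI[of _ ?f]) auto
qed

lemma pair_digraph_iso_iff:
  fixes A :: "'a pair_pre_digraph" and B :: "'b pair_pre_digraph"
  assumes "pair_wf_digraph A" "pair_wf_digraph B"
  shows "digraph_iso (with_proj A) (with_proj B) \<longleftrightarrow>
         (\<exists>h. bij_betw h (pverts A) (pverts B) \<and>
              (\<forall>u \<in> pverts A. \<forall>v \<in> pverts A. (u, v) \<in> parcs A \<longleftrightarrow> (h u, h v) \<in> parcs B))"
proof -
  have *: "with_proj C \<restriction> pverts C = with_proj C" if "pair_wf_digraph C"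
    for C :: "'c pair_pre_digraph"
  proof -
    interpret C: pair_wf_digraph C by fact
    show ?thesis by (intro pre_digraph.equality) (auto dest: C.wellformed')
  qed
  have "digraph_iso (with_proj A) (with_proj B) \<longleftrightarrow>
      (\<exists>h. iso_by h (with_proj A) (with_proj B))"
    by (auto simp: digraph_iso_def iso_by_def)
  also have "\<dots> \<longleftrightarrow> (\<exists>h. iso_by h (with_proj A \<restriction> pverts A) (with_proj B \<restriction> pverts B))"
    using *[OF assms(1)] *[OF assms(2)] by simp
  finally show ?thesis using iso_by_pair_iff[OF assms] by simp
qed

text \<open>Conditions (1) and (2) determine the helix.\<close>

lemma ex1_helix:
  assumes "cyclic_decomposition n G P D"
  shows "\<exists>!H. is_helix n G P D H"
proof -
  define Q where "Q x y \<longleftrightarrow>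
    (\<exists>i<n. \<exists>j j'. j < j' \<and> {x, y} \<subseteq> helix_segment n P D i j j')" for x y
  define E where "E = {(x, y). (helix_proj x, helix_proj y) \<in> parcs G \<and> Q x y}"
  define V where "V = (\<Union>i<n. \<Union>j. Copy j ` P i) \<union> Base ` D"
  define H where "H = \<lparr>pverts = V, parcs = E\<rparr>"
  have n: "3 \<le> n" and G: "pair_digraph G"
    and disj: "disjoint_family_on P {..<n}" "\<forall>i<n. P i \<inter> D = {}"
    using assms unfolding cyclic_decomposition_def by blast+
  interpret G: pair_digraph G by (rule G)
  have segV: "helix_segment n P D i j j' \<subseteq> V" if "i < n" for i j j'
  proof -
    have "(i + 1) mod n < n" using n by simp
    then show ?thesis unfolding helix_segment_def V_def using that by blast
  qed
  have loopfree: "pair_loopfree_digraph H"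
  proof unfold_locales
    fix e assume e: "e \<in> parcs H"
    obtain x y where xy: "e = (x, y)" by (cases e)
    have G: "(helix_proj x, helix_proj y) \<in> parcs G" and "Q x y"
      using e by (simp_all add: H_def E_def xy)
    then have "{x, y} \<subseteq> V" using segV unfolding Q_def by blast
    then show "fst e \<in> pverts H" "snd e \<in> pverts H" by (simp_all add: H_def xy)
    show "fst e \<noteq> snd e" using G.pair_no_loops[OF G] xy by auto
  qed
  then have wfH: "pair_wf_digraph H" by (simp add: pair_loopfree_digraph_def)
  have bij: "bij_betw helix_proj (helix_segment n P D i j j') (P i \<union> P ((i + 1) mod n) \<union> D)"
    if "i < n" for i j j'
  proof -
    have ne: "i \<noteq> (i + 1) mod n" using that n by (cases "i + 1 = n") auto
    have lt: "(i + 1) mod n < n" using n by simp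
    have "P i \<inter> P ((i + 1) mod n) = {}"
      using disjoint_family_onD[OF disj(1) _ _ ne] lt that by blast
    moreover have "P i \<inter> D = {}" "P ((i + 1) mod n) \<inter> D = {}"
      using disj(2) that lt by blast+
    moreover have "bij_betw helix_proj (Copy j ` A \<union> Copy j' ` B \<union> Base ` D) (A \<union> B \<union> D)"
      if "A \<inter> B = {}" "A \<inter> D = {}" "B \<inter> D = {}" for A B :: "'a set"
    proof -
      have "inj_on helix_proj (Copy j ` A \<union> Copy j' ` B \<union> Base ` D)"
        using that by (intro inj_onI) auto
      then show ?thesis by (simp add: bij_betw_def image_Un image_image)
    qed
    ultimately show ?thesis unfolding helix_segment_def by blast
  qed
  show ?thesis
  proof (rule ex1I[of _ H])
    have "iso_by helix_proj
        (with_proj H \<restriction> helix_segment n P D i j j')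
        (with_proj G \<restriction> (P i \<union> P ((i + 1) mod n) \<union> D))"
      if i: "i < n" "j < j'" for i j j'
    proof -
      have "Q u v" if "u \<in> helix_segment n P D i j j'" "v \<in> helix_segment n P D i j j'" for u v
        unfolding Q_def using i that by blast
      then have "\<forall>u \<in> helix_segment n P D i j j'. \<forall>v \<in> helix_segment n P D i j j'.
          (u, v) \<in> parcs H \<longleftrightarrow> (helix_proj u, helix_proj v) \<in> parcs G"
        by (simp add: H_def E_def)
      then show ?thesis
        using bij[OF i(1)] unfolding iso_by_pair_iff[OF wfH G.pair_wf_digraph_axioms] by blast
    qed
    moreover have "\<forall>(x, y) \<in> parcs H. Q x y" by (auto simp: H_def E_def)
    moreover have "pverts H = V" by (simp add: H_def)
    ultimately show "is_helix n G P D H"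
      using loopfree unfolding is_helix_def V_def[symmetric] Q_def[symmetric]
      by (intro conjI allI impI)
  next
    fix H' assume H': "is_helix n G P D H'"
    have verts': "pverts H' = V" and Q': "\<forall>(x, y) \<in> parcs H'. Q x y"
      and wf: "pair_wf_digraph H'"
      and iso': "\<And>i j j'. i < n \<Longrightarrow> j < j' \<Longrightarrow> iso_by helix_proj
          (with_proj H' \<restriction> helix_segment n P D i j j')
          (with_proj G \<restriction> (P i \<union> P ((i + 1) mod n) \<union> D))"
      using H' unfolding is_helix_def V_def[symmetric] Q_def[symmetric]
      by (simp_all add: pair_loopfree_digraph_def)
    have iff: "(x, y) \<in> parcs H' \<longleftrightarrow> (helix_proj x, helix_proj y) \<in> parcs G"
      if "Q x y" for x y
    proof -
      from that obtain i j j' where ij: "i < n" "j < j'"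
        and xy: "x \<in> helix_segment n P D i j j'" "y \<in> helix_segment n P D i j j'"
        unfolding Q_def by blast
      show ?thesis
        using iso'[OF ij] xy unfolding iso_by_pair_iff[OF wf G.pair_wf_digraph_axioms] by simp
    qed
    have "parcs H' = E" unfolding E_def using iff Q' by auto
    then show "H' = H" using verts' by (simp add: H_def)
  qed
qed

end

theory Submission
  imports Defs
begin

text \<open>
  Two walks are called homotopic if they are related by replacing pieces of at most three arcs by
  other such pieces with the same ends. Let \<open>N\<close> be \<open>r\<close> rounded up, so that \<open>4 \<le> N\<close>. The class
  consists of the finite digraphs without a fast loop, that is, without closed walks \<open>\<beta>\<close> and \<open>\<tau>\<close>
  at one vertex and a number \<open>b \<ge> 1\<close> such that \<open>\<beta>\<close> run \<open>b + 1\<close> times is homotopic to \<open>\<tau>\<close> run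
  \<open>b\<close> times, while \<open>\<beta>\<close> has fewer than \<open>b * N\<close> arcs. The relation between \<open>\<beta>\<close> and \<open>\<tau>\<close> says that
  they behave like the powers with exponents \<open>b\<close> and \<open>b + 1\<close> of one loop; since these exponents
  are coprime, every integer winding number of \<open>\<beta>\<close> is divisible by \<open>b\<close>. So a fast loop is one
  that needs fewer than \<open>N\<close> arcs per turn. Loops are compared through two powers and not with an
  actual root because a root of a loop through the core \<open>D\<close> of a decomposition may itself avoid
  \<open>D\<close>, and then it does not close up in the helix.

  Digraph homomorphisms map fast loops to fast loops, hence the class is closed under weak
  embeddings; a graph without closed walks belongs to it. On the circle \<open>N\<close> exceeds \<open>r\<close>, so for
  large \<open>b\<close> one can go round \<open>b\<close> times in \<open>b * N - 1\<close> steps. All walks with the same total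
  angle are homotopic, and the circle has a fast loop (\<open>fast_loop_circle\<close>).

  For a helix \<open>H\<close> of \<open>G\<close> with \<open>n \<ge> N\<close> parts around a core \<open>D\<close>, a fast loop of \<open>G\<close> yields one of
  \<open>H\<close> (\<open>fast_loop_helix\<close>), for the following reasons.

    \<^item> Outside \<open>D\<close>, the number of steps from one part to the next along a walk is a homotopy
      invariant: it is determined modulo \<open>n\<close> by the ends, and the replaced pieces have at most
      three arcs while \<open>n \<ge> 4\<close>. For a closed walk it is a multiple of \<open>n\<close>, and positive because
      the linear orders inside the parts contain no closed walk. For \<open>\<beta>\<close> it would be at least
      \<open>b * n\<close>, more than the number of arcs of \<open>\<beta>\<close>. Hence the homotopy of a fast loop meets \<open>D\<close>
      (\<open>fast_loop_meets_base\<close>).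

    \<^item> A fast loop can be moved to any vertex that its homotopy meets, at the price of a detour of
      bounded length, which becomes negligible when \<open>b\<close> is enlarged (\<open>fast_loop_rebase\<close>).

    \<^item> A walk that begins and ends in \<open>D\<close> lifts to the helix, and all its lifts are homotopic: there
      are infinitely many levels, so the levels of a lift can be raised block by block, where
      transitivity inside a part first reduces a block to at most two vertices. So closed walks
      at a vertex of \<open>D\<close> and their homotopies lift (\<open>homotopic_lift\<close>).
\<close>

section \<open>Walks and their homotopies\<close>

definition is_walk :: "('a \<times> 'a) set \<Rightarrow> 'a list \<Rightarrow> bool" where
  "is_walk E = successively (\<lambda>u v. (u, v) \<in> E)"

lemma is_walk_simps [simp]:
  "is_walk E []" "is_walk E [u]"
  "is_walk E (u # v # xs) \<longleftrightarrow> (u, v) \<in> E \<and> is_walk E (v # xs)"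
  by (simp_all add: is_walk_def)

lemma is_walk_append:
  "is_walk E (xs @ ys) \<longleftrightarrow>
     is_walk E xs \<and> is_walk E ys \<and> (xs = [] \<or> ys = [] \<or> (last xs, hd ys) \<in> E)"
  by (simp add: is_walk_def successively_append_iff)

lemma is_walk_glue:
  "ys \<noteq> [] \<Longrightarrow> is_walk E (xs @ ys) \<longleftrightarrow> is_walk E (xs @ [hd ys]) \<and> is_walk E ys"
  by (auto simp: is_walk_append)

lemma is_walk_map:
  assumes "is_walk E xs" and "\<And>u v. (u, v) \<in> E \<Longrightarrow> (f u, f v) \<in> E'"
  shows "is_walk E' (map f xs)"
  using assms(1) unfolding is_walk_def successively_map
  by (rule successively_mono) (rule assms(2))

lemma is_walk_finite:
  assumes "is_walk E xs"
  obtains F where "finite F" "F \<subseteq> E" "is_walk F xs"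
proof
  have "is_walk (E \<inter> set xs \<times> set xs) xs"
    using assms unfolding is_walk_def by (rule successively_mono) auto
  then show "is_walk (E \<inter> set xs \<times> set xs) xs" .
qed auto

lemma is_walk_mono: "is_walk E xs \<Longrightarrow> E \<subseteq> F \<Longrightarrow> is_walk F xs"
  unfolding is_walk_def by (erule successively_mono) auto

text \<open>
  Pieces of three arcs are the longest for which two pieces with common ends must make the same
  number of steps around a cycle of four or more parts, and the shortest that allow replacing
  two consecutive vertices at once.
\<close>

definition short_walk :: "('a \<times> 'a) set \<Rightarrow> 'a list \<Rightarrow> bool" where
  "short_walk E p \<longleftrightarrow> is_walk E p \<and> 2 \<le> length p \<and> length p \<le> 4"

definition elem_move :: "('a \<times> 'a) set \<Rightarrow> 'a list \<Rightarrow> 'a list \<Rightarrow> bool" where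
  "elem_move E xs ys \<longleftrightarrow>
     (\<exists>a p q c. xs = a @ p @ c \<and> ys = a @ q @ c \<and> short_walk E p \<and> short_walk E q \<and>
                hd p = hd q \<and> last p = last q)"

abbreviation homotopic :: "('a \<times> 'a) set \<Rightarrow> 'a list \<Rightarrow> 'a list \<Rightarrow> bool" where
  "homotopic E \<equiv> (elem_move E)\<^sup>*\<^sup>*"

lemma elem_moveI:
  "short_walk E p \<Longrightarrow> short_walk E q \<Longrightarrow> hd p = hd q \<Longrightarrow> last p = last q \<Longrightarrow>
   elem_move E (a @ p @ c) (a @ q @ c)"
  unfolding elem_move_def by blast

lemma homotopic_sym: "homotopic E xs ys \<Longrightarrow> homotopic E ys xs"
proof (induction rule: rtranclp_induct)
  case (step ys zs)
  have "elem_move E zs ys"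
    using step(2) unfolding elem_move_def by metis
  then show ?case using step(3) by (rule converse_rtranclp_into_rtranclp)
qed simp

lemma homotopic_context:
  assumes "homotopic E xs ys"
  shows "homotopic E (a @ xs @ c) (a @ ys @ c)"
  using assms
proof (induction rule: rtranclp_induct)
  case (step ys zs)
  obtain a' p q c' where "ys = a' @ p @ c'" "zs = a' @ q @ c'"
    "short_walk E p" "short_walk E q" "hd p = hd q" "last p = last q"
    using step(2) unfolding elem_move_def by blast
  then have "elem_move E (a @ ys @ c) (a @ zs @ c)"
    using elem_moveI[of E p q "a @ a'" "c' @ c"] by simp
  then show ?case using step(3) by (rule rtranclp.rtrancl_into_rtrancl[rotated])
qed simp

lemma homotopic_glue:
  assumes "homotopic E (xs @ [x]) (ys @ [x])" "zs \<noteq> []" "hd zs = x"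
  shows "homotopic E (a @ xs @ zs) (a @ ys @ zs)"
proof -
  have "zs = x # tl zs" using assms(2,3) by (cases zs) auto
  then show ?thesis using homotopic_context[OF assms(1), of a "tl zs"] by simp
qed

lemma homotopic_ends:
  assumes "homotopic E xs ys"
  shows "hd xs = hd ys \<and> last xs = last ys \<and> (xs = [] \<longleftrightarrow> ys = []) \<and> (is_walk E xs \<longleftrightarrow> is_walk E ys)"
  using assms
proof (induction rule: rtranclp_induct)
  case (step ys zs)
  obtain a p q c where eq: "ys = a @ p @ c" "zs = a @ q @ c"
    and pq: "short_walk E p" "short_walk E q" "hd p = hd q" "last p = last q"
    using step(2) unfolding elem_move_def by blast
  have "p \<noteq> []" "q \<noteq> []" "is_walk E p" "is_walk E q"
    using pq by (auto simp: short_walk_def)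
  then show ?case using step(3) pq unfolding eq
    by (cases "a = []"; cases "c = []") (auto simp: is_walk_append)
qed simp

lemma short_walk_map:
  "short_walk E p \<Longrightarrow> (\<And>u v. (u, v) \<in> E \<Longrightarrow> (f u, f v) \<in> E') \<Longrightarrow> short_walk E' (map f p)"
  unfolding short_walk_def by (auto intro: is_walk_map)

lemma homotopic_map:
  assumes "homotopic E xs ys" and f: "\<And>u v. (u, v) \<in> E \<Longrightarrow> (f u, f v) \<in> E'"
  shows "homotopic E' (map f xs) (map f ys)"
  using assms(1)
proof (induction rule: rtranclp_induct)
  case (step ys zs)
  obtain a p q c where eq: "ys = a @ p @ c" "zs = a @ q @ c"
    and pq: "short_walk E p" "short_walk E q" "hd p = hd q" "last p = last q"
    using step(2) unfolding elem_move_def by blast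
  have "p \<noteq> []" "q \<noteq> []" using pq by (auto simp: short_walk_def)
  then have "elem_move E' (map f ys) (map f zs)"
    unfolding eq map_append using pq
    by (intro elem_moveI short_walk_map[OF _ f]) (auto simp: hd_map last_map)
  then show ?case using step(3) by (rule rtranclp.rtrancl_into_rtrancl[rotated])
qed simp

lemma homotopic_mono: "homotopic E xs ys \<Longrightarrow> E \<subseteq> F \<Longrightarrow> homotopic F xs ys"
  using homotopic_map[of E xs ys id F] by auto

text \<open>
  Homotopies are finite objects; an infinite digraph with a fast loop therefore has a finite
  induced subgraph with one.
\<close>

lemma homotopic_finite:
  assumes "homotopic E xs ys"
  shows "\<exists>F. finite F \<and> F \<subseteq> E \<and> homotopic F xs ys"
  using assms
proof (induction rule: rtranclp_induct)
  case base
  show ?case by (intro exI[of _ "{}"]) auto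
next
  case (step ys zs)
  obtain F where F: "finite F" "F \<subseteq> E" "homotopic F xs ys" using step(3) by blast
  obtain a p q c where eq: "ys = a @ p @ c" "zs = a @ q @ c"
    and pq: "short_walk E p" "short_walk E q" "hd p = hd q" "last p = last q"
    using step(2) unfolding elem_move_def by blast
  obtain P Q where P: "finite P" "P \<subseteq> E" "is_walk P p" and Q: "finite Q" "Q \<subseteq> E" "is_walk Q q"
    using pq is_walk_finite unfolding short_walk_def by metis
  let ?F = "F \<union> P \<union> Q"
  have "homotopic ?F xs ys" using F(3) by (rule homotopic_mono) auto
  moreover have "elem_move ?F ys zs"
    unfolding eq using pq P(3) Q(3)
    by (intro elem_moveI) (auto simp: short_walk_def elim: is_walk_mono)
  ultimately have "homotopic ?F xs zs" by (rule rtranclp.rtrancl_into_rtrancl)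
  then show ?case using F P Q by (intro exI[of _ ?F]) auto
qed

section \<open>Fast loops\<close>

definition laps :: "nat \<Rightarrow> 'a list \<Rightarrow> 'a list" where
  "laps k bs = concat (replicate k bs)"

lemma laps_simps [simp]: "laps 0 bs = []" "laps (Suc k) bs = bs @ laps k bs"
  by (simp_all add: laps_def)

lemma laps_add: "laps (i + j) bs = laps i bs @ laps j bs"
  by (induction i) simp_all

lemma laps_mult: "laps (i * j) bs = laps i (laps j bs)"
  by (induction i) (simp_all add: laps_add)

lemma laps_eq_Nil [simp]: "laps k bs = [] \<longleftrightarrow> k = 0 \<or> bs = []"
  by (induction k) auto

lemma length_laps [simp]: "length (laps k bs) = k * length bs"
  by (induction k) auto

lemma map_laps: "map f (laps k bs) = laps k (map f bs)"
  by (induction k) auto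

lemma hd_laps: "hd (bs @ [x]) = x \<Longrightarrow> hd (laps k bs @ [x]) = x"
  by (induction k) (auto simp: hd_append)

text \<open>
  A closed walk is represented by its list of vertices without the final return to \<open>x\<close>, so that
  going round several times is concatenation.
\<close>

definition closed_walk :: "('a \<times> 'a) set \<Rightarrow> 'a \<Rightarrow> 'a list \<Rightarrow> bool" where
  "closed_walk E x bs \<longleftrightarrow> bs \<noteq> [] \<and> hd bs = x \<and> is_walk E (bs @ [x])"

lemma closed_walk_laps:
  assumes "closed_walk E x bs"
  shows "is_walk E (laps k bs @ [x])"
proof (induction k)
  case (Suc k)
  have "hd (laps k bs @ [x]) = x"
    using assms by (intro hd_laps) (auto simp: closed_walk_def)
  then show ?case
    using Suc assms is_walk_glue[of "laps k bs @ [x]" E bs] by (simp add: closed_walk_def)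
qed simp

lemma homotopic_laps:
  assumes "homotopic E (xs @ [x]) (ys @ [x])" "hd (ys @ [x]) = x"
  shows "homotopic E (laps k xs @ [x]) (laps k ys @ [x])"
proof (induction k)
  case (Suc k)
  have "homotopic E (xs @ laps k xs @ [x]) (xs @ laps k ys @ [x])"
    using homotopic_context[OF Suc, of xs "[]"] by simp
  moreover have "homotopic E ([] @ xs @ (laps k ys @ [x])) ([] @ ys @ (laps k ys @ [x]))"
    by (rule homotopic_glue[OF assms(1)]) (use assms(2) hd_laps in auto)
  ultimately show ?case by simp
qed simp

text \<open>
  \<open>bs\<close> and \<open>ts\<close> play the roles of the powers with exponents \<open>b\<close> and \<open>b + 1\<close> of a loop that need
  not exist; the last condition says that this loop would use fewer than \<open>N\<close> arcs per turn.
\<close>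

definition fast_loop_at :: "nat \<Rightarrow> ('a \<times> 'a) set \<Rightarrow> 'a \<Rightarrow> bool" where
  "fast_loop_at N E x \<longleftrightarrow>
     (\<exists>b bs ts. 1 \<le> b \<and> closed_walk E x bs \<and> closed_walk E x ts \<and>
        homotopic E (laps (Suc b) bs @ [x]) (laps b ts @ [x]) \<and> length bs < b * N)"

definition fast_loop :: "nat \<Rightarrow> ('a \<times> 'a) set \<Rightarrow> bool" where
  "fast_loop N E \<longleftrightarrow> (\<exists>x. fast_loop_at N E x)"

lemma fast_loop_map:
  assumes "fast_loop N E" and f: "\<And>u v. (u, v) \<in> E \<Longrightarrow> (f u, f v) \<in> E'"
  shows "fast_loop N E'"
proof -
  obtain x b bs ts where *: "1 \<le> b" "closed_walk E x bs" "closed_walk E x ts"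
    "homotopic E (laps (Suc b) bs @ [x]) (laps b ts @ [x])" "length bs < b * N"
    using assms(1) unfolding fast_loop_def fast_loop_at_def by blast
  have closed: "closed_walk E' (f x) (map f cs)" if "closed_walk E x cs" for cs
    using that is_walk_map[of E "cs @ [x]" f E', OF _ f] by (auto simp: closed_walk_def hd_map)
  have "homotopic E' (laps (Suc b) (map f bs) @ [f x]) (laps b (map f ts) @ [f x])"
    using homotopic_map[OF *(4) f] by (simp add: map_laps)
  then show ?thesis
    using *(1,5) closed[OF *(2)] closed[OF *(3)]
    unfolding fast_loop_def fast_loop_at_def
    by (intro exI[of _ "f x"] exI[of _ b] exI[of _ "map f bs"] exI[of _ "map f ts"]) simp
qed

lemma fast_loop_finite:
  assumes "fast_loop N E"
  obtains F where "finite F" "F \<subseteq> E" "fast_loop N F"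
proof -
  obtain x b bs ts where *: "1 \<le> b" "closed_walk E x bs" "closed_walk E x ts"
    "homotopic E (laps (Suc b) bs @ [x]) (laps b ts @ [x])" "length bs < b * N"
    using assms(1) unfolding fast_loop_def fast_loop_at_def by blast
  obtain B T where B: "finite B" "B \<subseteq> E" "is_walk B (bs @ [x])"
    and T: "finite T" "T \<subseteq> E" "is_walk T (ts @ [x])"
    using *(2,3) is_walk_finite unfolding closed_walk_def by metis
  obtain F where F: "finite F" "F \<subseteq> E" "homotopic F (laps (Suc b) bs @ [x]) (laps b ts @ [x])"
    using homotopic_finite[OF *(4)] by blast
  let ?F = "F \<union> B \<union> T"
  have "fast_loop_at N ?F x"
    unfolding fast_loop_at_def closed_walk_def
    using * is_walk_mono[OF B(3), of ?F] is_walk_mono[OF T(3), of ?F] homotopic_mono[OF F(3), of ?F]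
    by (intro exI[of _ b] exI[of _ bs] exI[of _ ts]) (auto simp: closed_walk_def)
  then show thesis
    using F B T by (intro that[of ?F]) (auto simp: fast_loop_def)
qed

section \<open>Moving the base point of a fast loop\<close>

text \<open>
  If \<open>eta\<close> leads from \<open>x\<close> to \<open>d\<close> and \<open>ze\<close> back from \<open>d\<close> to \<open>x\<close>, then running the loop
  \<open>ze @ laps s om @ eta\<close> repeatedly passes through \<open>eta @ ze\<close> between consecutive turns, and each
  such passage counts as \<open>k\<close> laps of \<open>om\<close>.
\<close>

lemma laps_between:
  assumes om: "closed_walk E x om" and hom: "homotopic E (laps k om @ [x]) (eta @ ze @ [x])"
    and eta: "hd (eta @ [d]) = x"
  shows "homotopic E (laps (Suc m) (ze @ laps s om @ eta) @ [d])
                     (ze @ laps (s + (s + k) * m) om @ eta @ [d])"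
proof (induction m)
  case (Suc m)
  let ?l = "\<lambda>m. s + (s + k) * m"
  have hd: "hd (laps i om @ eta @ [d]) = x" for i
    using eta hd_laps[of om x i] om by (cases "laps i om = []") (auto simp: closed_walk_def hd_append2)
  have "homotopic E (laps (Suc (Suc m)) (ze @ laps s om @ eta) @ [d])
          ((ze @ laps s om @ eta) @ (ze @ laps (?l m) om @ eta @ [d]))"
    using homotopic_context[OF Suc, of "ze @ laps s om @ eta" "[]"] by simp
  also have "homotopic E \<dots> ((ze @ laps s om) @ laps k om @ (laps (?l m) om @ eta @ [d]))"
    using homotopic_glue[of E "eta @ ze" x "laps k om" "laps (?l m) om @ eta @ [d]" "ze @ laps s om"]
      homotopic_sym[OF hom] hd by simp
  also have "\<dots> = ze @ laps (?l (Suc m)) om @ eta @ [d]"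
    by (simp add: laps_add algebra_simps flip: append_assoc) (simp add: laps_add[symmetric] add_ac)
  finally show ?case by simp
qed simp

text \<open>
  Count \<open>bs\<close> with exponent \<open>b\<close> and \<open>ts\<close> with exponent \<open>b + 1\<close>. A walk \<open>eta @ ze\<close> homotopic to
  \<open>laps (Suc b) bs\<close> then has exponent \<open>b * (b + 1)\<close>, so the loops at \<open>d\<close> made of \<open>ze\<close>, \<open>s\<close> laps of
  \<open>bs\<close> or \<open>t\<close> laps of \<open>ts\<close>, and \<open>eta\<close> have exponents \<open>b * (s + b + 1)\<close> and \<open>(b + 1) * (t + b)\<close>.
  Suitable \<open>s\<close> and \<open>t\<close> make these consecutive numbers and as large as desired. Every lap of \<open>bs\<close>
  saves at least one arc against \<open>b * N\<close>, so many laps pay for the detour through \<open>eta\<close> and \<open>ze\<close>.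
\<close>

lemma fast_loop_rebase:
  assumes b: "1 \<le> b" and bs: "closed_walk E x bs" and ts: "closed_walk E x ts"
    and hom: "homotopic E (laps (Suc b) bs @ [x]) (laps b ts @ [x])" and len: "length bs < b * N"
    and zs: "homotopic E (laps (Suc b) bs @ [x]) zs" "d \<in> set zs"
  shows "fast_loop_at N E d"
proof (cases "d = x")
  case True
  then show ?thesis using assms unfolding fast_loop_at_def by blast
next
  case False
  have ends: "hd zs = x" "last zs = x" "zs \<noteq> []" "is_walk E zs"
    using homotopic_ends[OF zs(1)] closed_walk_laps[OF bs, of "Suc b"] hd_laps[of bs x "Suc b"] bs
    by (auto simp: closed_walk_def)
  have "zs = butlast zs @ [x]" using ends(2,3) append_butlast_last_id[of zs] by simp
  then have "set zs = set (butlast zs) \<union> {x}" by (metis set_append list.simps(15) empty_set)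
  then obtain eta ze' where split: "butlast zs = eta @ d # ze'"
    using zs(2) False split_list[of d "butlast zs"] by auto
  define ze where "ze = d # ze'"
  have zs_eq: "zs = eta @ ze @ [x]"
    using split ends(2,3) append_butlast_last_id[of zs] by (simp add: ze_def)
  have eta: "hd (eta @ [d]) = x" "eta \<noteq> []"
    using ends(1) False unfolding zs_eq ze_def by (cases eta; simp)+
  have homB: "homotopic E (laps (Suc b) bs @ [x]) (eta @ ze @ [x])"
    using zs zs_eq by simp
  have homT: "homotopic E (laps b ts @ [x]) (eta @ ze @ [x])"
    using homotopic_sym[OF hom] homB by simp
  have walk: "is_walk E (ze @ laps i cs @ eta @ [d])" if "closed_walk E x cs" for i cs
  proof -
    have "is_walk E (eta @ [d])" "is_walk E (ze @ [x])"
      using ends(4) unfolding zs_eq ze_def by (auto simp: is_walk_append)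
    moreover have "hd (laps i cs @ eta @ [d]) = x"
      using eta hd_laps[of cs x i] that by (cases "laps i cs = []") (auto simp: closed_walk_def hd_append2)
    ultimately show ?thesis
      using is_walk_glue[of "laps i cs @ eta @ [d]" E ze] is_walk_glue[of "eta @ [d]" E "laps i cs"]
        closed_walk_laps[OF that, of i] eta by simp
  qed
  \<comment> \<open>More than \<open>j\<close> laps of \<open>bs\<close> are run, which saves more arcs than the detour costs.\<close>
  define j where "j = length ze + length eta"
  define s where "s = 1 + j * Suc b"
  define t where "t = 1 + j * b"
  define b' where "b' = b * (1 + Suc j * Suc b)"
  let ?B = "ze @ laps s bs @ eta" and ?T = "ze @ laps t ts @ eta"
  have closed: "closed_walk E d ?B" "closed_walk E d ?T"
    using walk[OF bs, of s] walk[OF ts, of t] by (simp_all add: closed_walk_def ze_def)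
  \<comment> \<open>Both loops amount to \<open>X\<close> copies of \<open>laps (Suc b) bs\<close>, equivalently of \<open>laps b ts\<close>,
      enclosed between \<open>ze\<close> and \<open>eta\<close>.\<close>
  define X where "X = (1 + Suc j * Suc b) * (1 + Suc j * b) - 1"
  have SX: "Suc X = (1 + Suc j * Suc b) * (1 + Suc j * b)"
    unfolding X_def by simp
  have b'_pos: "Suc (b' - 1) = b'" using b by (simp add: b'_def)
  have X1: "s + (s + Suc b) * b' = X * Suc b"
  proof -
    have "Suc b' = Suc b * (1 + Suc j * b)" by (simp add: b'_def algebra_simps)
    then have "(s + Suc b) * Suc b' = Suc X * Suc b"
      unfolding SX by (simp add: s_def algebra_simps)
    then show ?thesis by simp
  qed
  have X2: "t + (t + b) * (b' - 1) = X * b"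
  proof -
    have "(t + b) * Suc (b' - 1) = Suc X * b"
      unfolding SX b'_pos by (simp add: t_def b'_def algebra_simps)
    then show ?thesis by simp
  qed
  have "homotopic E (laps (Suc b') ?B @ [d]) (ze @ laps X (laps (Suc b) bs) @ eta @ [d])"
    using laps_between[OF bs homB eta(1), of b' s]
    unfolding X1 laps_mult .
  also have "homotopic E \<dots> (ze @ laps X (laps b ts) @ eta @ [d])"
  proof (rule homotopic_glue)
    show "homotopic E (laps X (laps (Suc b) bs) @ [x]) (laps X (laps b ts) @ [x])"
      using hom hd_laps[of ts x b] ts by (intro homotopic_laps) (auto simp: closed_walk_def)
  qed (use eta in auto)
  also have "homotopic E \<dots> (laps b' ?T @ [d])"
    using homotopic_sym[OF laps_between[OF ts homT eta(1), of "b' - 1" t]]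
    unfolding X2 laps_mult b'_pos .
  finally have "homotopic E (laps (Suc b') ?B @ [d]) (laps b' ?T @ [d])" .
  moreover have "length ?B < b' * N"
  proof -
    have "s * length bs + s \<le> s * (b * N)"
      using len mult_le_mono2[of "Suc (length bs)" "b * N" s] by simp
    moreover have "s * (b * N) \<le> b' * N" "j < s"
      unfolding s_def b'_def by (simp_all add: algebra_simps)
    ultimately show ?thesis unfolding j_def length_append length_laps by linarith
  qed
  moreover have "1 \<le> b'" using b by (simp add: b'_def)
  ultimately show ?thesis using closed unfolding fast_loop_at_def by blast
qed

section \<open>Walks that stay inside the parts\<close>

lemma add_mod_cancel:
  fixes a s t n :: nat
  assumes "(a + s) mod n = (a + t) mod n" "s < n" "t < n"
  shows "s = t"
  using assms
proof (induction s t rule: linorder_wlog)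
  case (le s t)
  then have "n dvd (a + t) - (a + s)" using mod_eq_dvd_iff_nat[of "a + s" "a + t" n] by simp
  then show ?case using le by (auto dest: dvd_imp_le)
qed simp

text \<open>
  A cyclic decomposition seen through its arcs: \<open>part v\<close> is the index of the part containing \<open>v\<close>,
  and it is \<open>None\<close> on the core \<open>D\<close>. The interval condition enters as transitivity inside
  a part; together with irreflexivity it excludes closed walks inside a part.
\<close>

locale cyclic_parts =
  fixes E :: "('a \<times> 'a) set" and part :: "'a \<Rightarrow> nat option" and n :: nat
  assumes four_le: "4 \<le> n"
    and part_less: "part u = Some i \<Longrightarrow> i < n"
    and part_arc: "(u, v) \<in> E \<Longrightarrow> part u = Some i \<Longrightarrow> part v = Some k \<Longrightarrow>
                     k = i \<or> k = Suc i mod n"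
    and part_trans: "(u, v) \<in> E \<Longrightarrow> (v, w) \<in> E \<Longrightarrow> part u \<noteq> None \<Longrightarrow>
                     part u = part v \<Longrightarrow> part v = part w \<Longrightarrow> (u, w) \<in> E"
    and irrefl: "(u, u) \<notin> E"
begin

text \<open>
  Arcs that meet the core count as steps too. This makes the number of steps a safe amount by which
  the level may rise along a lift.
\<close>

definition step :: "'a \<Rightarrow> 'a \<Rightarrow> nat" where
  "step u v = (if part u = part v \<and> part u \<noteq> None then 0 else 1)"

fun steps :: "'a list \<Rightarrow> nat" where
  "steps (u # v # xs) = step u v + steps (v # xs)"
| "steps _ = 0"

lemma steps_append: "steps (xs @ v # ys) = steps (xs @ [v]) + steps (v # ys)"
  by (induction xs rule: induct_list012) auto

lemma steps_glue: "zs \<noteq> [] \<Longrightarrow> steps (xs @ zs) = steps (xs @ [hd zs]) + steps zs"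
  using steps_append[of xs "hd zs" "tl zs"] by simp

lemma steps_infix:
  assumes "p \<noteq> []"
  shows "steps (a @ p @ c) = steps (a @ [hd p]) + steps p + steps (last p # c)"
proof -
  have "steps (p @ c) = steps p + steps (last p # c)"
    using steps_append[of "butlast p" "last p" c] unfolding append_butlast_last_id[OF assms]
    by (metis append_butlast_last_id assms append_assoc append_Cons append_Nil)
  then show ?thesis using steps_glue[of "p @ c" a] assms by simp
qed

lemma steps_less: "xs \<noteq> [] \<Longrightarrow> steps xs < length xs"
  by (induction xs rule: steps.induct) (auto simp: step_def)

lemma steps_part:
  assumes "is_walk E xs" "xs \<noteq> []" "\<forall>v \<in> set xs. part v \<noteq> None"
  shows "the (part (last xs)) = (the (part (hd xs)) + steps xs) mod n"
  using assms
proof (induction xs rule: induct_list012)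
  case (2 u)
  then show ?case using part_less by auto
next
  case (3 u v xs)
  obtain i k where ik: "part u = Some i" "part v = Some k" using 3(5) by auto
  have uv: "k = i \<or> k = Suc i mod n" using 3(3) ik part_arc by auto
  have "(k + steps (v # xs)) mod n = (i + steps (u # v # xs)) mod n"
  proof (cases "k = i")
    case False
    then have "k = Suc i mod n" "step u v = 1" using uv ik by (auto simp: step_def)
    then show ?thesis by (simp add: mod_add_left_eq)
  qed (simp add: step_def ik)
  then show ?case using 3 ik by (simp add: 3)
qed simp

lemma steps_eq_0:
  assumes "is_walk E xs" "2 \<le> length xs" "\<forall>v \<in> set xs. part v \<noteq> None" "steps xs = 0"
  shows "(hd xs, last xs) \<in> E \<and> part (hd xs) = part (last xs)"
  using assms
proof (induction xs rule: induct_list012)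
  case (3 u v xs)
  have uv: "(u, v) \<in> E" "part u = part v" "steps (v # xs) = 0"
    using 3 by (auto simp: step_def split: if_splits)
  show ?case
  proof (cases xs)
    case (Cons w ws)
    then have "(v, last xs) \<in> E" "part v = part (last xs)"
      using 3 uv by auto
    then show ?thesis using uv part_trans[of u v "last xs"] 3(5) Cons by auto
  qed (use uv in simp)
qed auto

lemma steps_closed:
  assumes "closed_walk E x bs" "\<forall>v \<in> set bs. part v \<noteq> None"
  shows "n dvd steps (bs @ [x])" "0 < steps (bs @ [x])" "steps (bs @ [x]) \<le> length bs"
proof -
  have bs: "bs \<noteq> []" "hd bs = x" "is_walk E (bs @ [x])"
    using assms by (auto simp: closed_walk_def)
  have p: "\<forall>v \<in> set (bs @ [x]). part v \<noteq> None" using assms(2) bs by (cases bs) auto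
  show "0 < steps (bs @ [x])"
    using steps_eq_0[OF bs(3) _ p] bs irrefl by (cases bs) auto
  show "steps (bs @ [x]) \<le> length bs" using steps_less[of "bs @ [x]"] by simp
  obtain i where i: "part x = Some i" using p by auto
  have "(i + steps (bs @ [x])) mod n = i mod n"
    using steps_part[OF bs(3) _ p] bs i part_less by simp
  then show "n dvd steps (bs @ [x])"
    using mod_eq_dvd_iff_nat[of i "i + steps (bs @ [x])" n] by simp
qed

lemma steps_laps:
  assumes "hd (bs @ [x]) = x"
  shows "steps (laps k bs @ [x]) = k * steps (bs @ [x])"
proof (induction k)
  case (Suc k)
  then show ?case
    using steps_glue[of "laps k bs @ [x]" bs] hd_laps[OF assms, of k] by simp
qed simp

lemma steps_elem_move:
  assumes "elem_move E xs ys" "\<forall>v \<in> set xs \<union> set ys. part v \<noteq> None"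
  shows "steps xs = steps ys"
proof -
  obtain a p q c where eq: "xs = a @ p @ c" "ys = a @ q @ c"
    and pq: "short_walk E p" "short_walk E q" "hd p = hd q" "last p = last q"
    using assms(1) unfolding elem_move_def by blast
  have ne: "p \<noteq> []" "q \<noteq> []" using pq by (auto simp: short_walk_def)
  have lt: "steps p < n" "steps q < n"
    using steps_less[OF ne(1)] steps_less[OF ne(2)] pq four_le by (auto simp: short_walk_def)
  have "(the (part (hd p)) + steps p) mod n = (the (part (hd p)) + steps q) mod n"
    using steps_part[of p] steps_part[of q] pq ne assms(2) eq by (auto simp: short_walk_def)
  then have "steps p = steps q" using lt by (rule add_mod_cancel)
  then show ?thesis
    using pq unfolding eq steps_infix[OF ne(1)] steps_infix[OF ne(2)] by simp
qed

text \<open>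
  If every walk in the homotopy class avoided the core, the number of steps would be invariant, so
  \<open>b + 1\<close> times that of \<open>bs\<close> would equal \<open>b\<close> times that of \<open>ts\<close>. Both are multiples of \<open>n\<close>, and
  \<open>b\<close> is coprime to \<open>b + 1\<close>; hence \<open>bs\<close> would make at least \<open>b * n\<close> steps.
\<close>

lemma fast_loop_meets_base:
  assumes "1 \<le> b" "closed_walk E x bs" "closed_walk E x ts"
    and hom: "homotopic E (laps (Suc b) bs @ [x]) (laps b ts @ [x])" and "length bs < b * n"
  shows "\<exists>zs. homotopic E (laps (Suc b) bs @ [x]) zs \<and> (\<exists>d \<in> set zs. part d = None)"
proof (rule ccontr)
  assume "\<not> ?thesis"
  then have avoid: "homotopic E (laps (Suc b) bs @ [x]) zs \<Longrightarrow> \<forall>v \<in> set zs. part v \<noteq> None" for zs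
    by metis
  have "steps (laps (Suc b) bs @ [x]) = steps zs" if "homotopic E (laps (Suc b) bs @ [x]) zs" for zs
    using that
  proof (induction rule: rtranclp_induct)
    case (step ys zs)
    have "homotopic E (laps (Suc b) bs @ [x]) zs" using step(1,2) by simp
    then have "steps ys = steps zs"
      using avoid step by (intro steps_elem_move) auto
    then show ?case using step by simp
  qed simp
  from this[OF hom] have eq: "Suc b * steps (bs @ [x]) = b * steps (ts @ [x])"
    using steps_laps[of bs x "Suc b"] steps_laps[of ts x b] assms(2,3)
    by (simp add: closed_walk_def del: laps_simps)
  have bs: "\<forall>v \<in> set bs. part v \<noteq> None" using avoid[of "laps (Suc b) bs @ [x]"] by auto
  have "set ts \<subseteq> set (laps b ts)" using assms(1) by (cases b) auto
  then have ts: "\<forall>v \<in> set ts. part v \<noteq> None" using avoid[OF hom] by auto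
  obtain u w where uw: "steps (bs @ [x]) = n * u" "steps (ts @ [x]) = n * w"
    using steps_closed(1)[OF assms(2) bs] steps_closed(1)[OF assms(3) ts] by (auto elim!: dvdE)
  have "n * (Suc b * u) = n * (b * w)" using eq unfolding uw by (simp only: mult_ac)
  then have "Suc b * u = b * w" using four_le by simp
  then have "b dvd Suc b * u" by simp
  moreover have "coprime b (Suc b)" by simp
  ultimately have "b dvd u" using coprime_dvd_mult_right_iff by blast
  moreover have "0 < u" using steps_closed(2)[OF assms(2) bs] uw by simp
  ultimately have "b \<le> u" by (rule dvd_imp_le)
  then have "b * n \<le> n * u" by simp
  then show False using steps_closed(3)[OF assms(2) bs] uw(1) assms(5) by linarith
qed

section \<open>Lifting walks to the helix\<close>

fun on_helix :: "'a helix_vertex \<Rightarrow> bool" where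
  "on_helix (Base v) \<longleftrightarrow> part v = None"
| "on_helix (Copy j v) \<longleftrightarrow> part v \<noteq> None"

text \<open>
  Arcs of the helix between copies: a part is joined to the next one only upwards, and there are no
  arcs between different copies of one part. Since arcs of \<open>E\<close> between different parts lead
  to the next part, the direction of the arc fixes which level is the higher one.
\<close>

fun climbs :: "'a helix_vertex \<Rightarrow> 'a helix_vertex \<Rightarrow> bool" where
  "climbs (Copy j u) (Copy k v) \<longleftrightarrow> (if part u = part v then j = k else j < k)"
| "climbs _ _ \<longleftrightarrow> True"

definition helix_arcs :: "('a helix_vertex \<times> 'a helix_vertex) set" where
  "helix_arcs = {(x, y). (helix_proj x, helix_proj y) \<in> E \<and> on_helix x \<and> on_helix y \<and> climbs x y}"

definition is_lift :: "'a helix_vertex list \<Rightarrow> 'a list \<Rightarrow> bool" where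
  "is_lift X xs \<longleftrightarrow> is_walk helix_arcs X \<and> map helix_proj X = xs \<and> (\<forall>x \<in> set X. on_helix x)"

lemma is_lift_glue:
  assumes "is_lift X xs" "is_lift Y ys" "X \<noteq> []" "Y \<noteq> []" "last X = hd Y"
  shows "is_lift (butlast X @ Y) (butlast xs @ ys)"
proof -
  have "X = butlast X @ [hd Y]" using assms(3,5) append_butlast_last_id by metis
  then have "is_walk helix_arcs (butlast X @ Y)"
    using assms(1,2) is_walk_glue[OF assms(4), of helix_arcs "butlast X"] by (simp add: is_lift_def)
  then show ?thesis using assms by (auto simp: is_lift_def map_butlast dest: in_set_butlastD)
qed

definition at_level :: "nat \<Rightarrow> 'a \<Rightarrow> 'a helix_vertex" where
  "at_level j v = (if part v = None then Base v else Copy j v)"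

lemma helix_proj_at_level [simp]: "helix_proj (at_level j v) = v"
  by (simp add: at_level_def)

lemma on_helix_at_level [simp]: "on_helix (at_level j v)"
  by (simp add: at_level_def)

lemma climbs_at_level: "climbs (at_level j u) (at_level (j + step u v) v)"
  by (auto simp: at_level_def step_def)

text \<open>
  The canonical lift from level \<open>j\<close> goes up by one whenever the walk changes its part.
\<close>

fun lift :: "nat \<Rightarrow> 'a list \<Rightarrow> 'a helix_vertex list" where
  "lift j (u # v # xs) = at_level j u # lift (j + step u v) (v # xs)"
| "lift j [u] = [at_level j u]"
| "lift j [] = []"

lemma hd_lift: "xs \<noteq> [] \<Longrightarrow> hd (lift j xs) = at_level j (hd xs)"
  by (cases xs rule: remdups_adj.cases) auto

lemma lift_eq_Nil [simp]: "lift j xs = [] \<longleftrightarrow> xs = []"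
  by (cases xs rule: remdups_adj.cases) auto

lemma last_lift: "xs \<noteq> [] \<Longrightarrow> last (lift j xs) = at_level (j + steps xs) (last xs)"
  by (induction j xs rule: lift.induct) (auto simp: add.assoc)

lemma is_lift_lift: "is_walk E xs \<Longrightarrow> is_lift (lift j xs) xs"
proof (induction j xs rule: lift.induct)
  case (1 j u v xs)
  obtain Z where Z: "lift (j + step u v) (v # xs) = at_level (j + step u v) v # Z"
    using hd_lift[of "v # xs" "j + step u v"] by (cases "lift (j + step u v) (v # xs)") auto
  have "(at_level j u, at_level (j + step u v) v) \<in> helix_arcs"
    using 1 climbs_at_level by (simp add: helix_arcs_def)
  then show ?case using 1 by (auto simp: is_lift_def Z)
qed (auto simp: is_lift_def)

text \<open>
  Outside the core the levels of the ends of a lift have to differ by at least the number of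
  steps. A core vertex lies on no level, so after it the lift can start again from the level
  from which the canonical lift ends at \<open>k\<close>.
\<close>

lemma lift_between:
  assumes p: "is_walk E p" "p \<noteq> []"
    and k: "if \<exists>d \<in> set p. part d = None then length p \<le> k else k = j + steps p"
  shows "\<exists>X. is_lift X p \<and> hd X = at_level j (hd p) \<and> last X = at_level k (last p)"
proof (cases "\<exists>d \<in> set p. part d = None")
  case True
  then obtain d p1 p2 where split: "p = p1 @ d # p2" and d: "part d = None"
    by (metis split_list)
  let ?i = "k - steps (d # p2)"
  let ?X = "lift j (p1 @ [d])" and ?Y = "lift ?i (d # p2)"
  have i: "?i + steps (d # p2) = k"
    using k True steps_less[of "d # p2"] by (simp add: split)
  have walks: "is_walk E (p1 @ [d])" "is_walk E (d # p2)"
    using p(1) is_walk_glue[of "d # p2" E p1] by (simp_all add: split)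
  have join: "last ?X = hd ?Y"
    using last_lift[of "p1 @ [d]" j] hd_lift[of "d # p2" ?i] d by (simp add: at_level_def)
  have "is_lift (butlast ?X @ ?Y) p"
    using is_lift_glue[OF is_lift_lift[OF walks(1), of j] is_lift_lift[OF walks(2), of ?i] _ _ join]
    by (simp add: split)
  moreover have "hd (butlast ?X @ ?Y) = at_level j (hd p)"
  proof (cases p1)
    case Nil
    then show ?thesis using hd_lift[of "d # p2" ?i] d by (simp add: split at_level_def)
  next
    case (Cons u us)
    then have "butlast ?X \<noteq> []" using \<open>is_walk E (p1 @ [d])\<close>
      by (cases us) auto
    then have "hd (butlast ?X @ ?Y) = hd ?X"
      by (cases ?X) auto
    then show ?thesis using hd_lift[of "p1 @ [d]" j] Cons by (simp add: split)
  qed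
  moreover have "last (butlast ?X @ ?Y) = at_level k (last p)"
    using last_lift[of "d # p2" ?i] i by (simp add: split)
  ultimately show ?thesis by blast
next
  case False
  then have "k = j + steps p" using k by simp
  then show ?thesis
    using is_lift_lift[OF p(1), of j] hd_lift[OF p(2), of j] last_lift[OF p(2), of j] by auto
qed

text \<open>
  The two pieces need lifts with the same ends. If both avoid the core they make the same number
  of steps. If one of them meets the core, its ends can be put on whatever levels the other one
  requires.
\<close>

lemma elem_move_lift:
  assumes move: "elem_move E xs ys" and walk: "is_walk E xs" and base: "part (hd xs) = None"
  shows "\<exists>X Y. is_lift X xs \<and> is_lift Y ys \<and> elem_move helix_arcs X Y"
proof -
  obtain a p q c where eq: "xs = a @ p @ c" "ys = a @ q @ c"
    and pq: "short_walk E p" "short_walk E q" "hd p = hd q" "last p = last q"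
    using move unfolding elem_move_def by blast
  have ne: "p \<noteq> []" "q \<noteq> []" and wpq: "is_walk E p" "is_walk E q"
    and len: "length p \<le> 4" "length q \<le> 4" using pq by (auto simp: short_walk_def)
  have wa: "is_walk E (a @ [hd p])" and wc: "is_walk E (last p # c)"
    using walk ne is_walk_append[of E "[last p]" c] unfolding eq by (auto simp: is_walk_append)
  \<comment> \<open>The whole lift starts at level 4. So the last vertex of a piece lies high enough for the
      piece, which has at most four vertices, to climb to it from a core vertex.\<close>
  define j where "j = 4 + steps (a @ [hd p])"
  define avoids where "avoids z \<longleftrightarrow> (\<forall>v \<in> set z. part v \<noteq> None)" for z :: "'a list"
  define k where "k = (if avoids p then j + steps p else if avoids q then j + steps q else j)"
  have "steps p = steps q" if "avoids p" "avoids q"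
  proof -
    have "elem_move E ([] @ p @ []) ([] @ q @ [])" using pq by (intro elem_moveI)
    then show ?thesis using that steps_elem_move[of p q] by (auto simp: avoids_def)
  qed
  then have kp: "if \<exists>d \<in> set p. part d = None then length p \<le> k else k = j + steps p"
    and kq: "if \<exists>d \<in> set q. part d = None then length q \<le> k else k = j + steps q"
    using len by (auto simp: k_def avoids_def j_def)
  obtain P where P: "is_lift P p" "hd P = at_level j (hd p)" "last P = at_level k (last p)"
    using lift_between[OF wpq(1) ne(1) kp] by blast
  obtain Q where Q: "is_lift Q q" "hd Q = at_level j (hd p)" "last Q = at_level k (last p)"
    using lift_between[OF wpq(2) ne(2) kq] pq(3,4) by auto
  define A where "A = lift 4 (a @ [hd p])"
  define C where "C = lift k (last p # c)"
  have A: "is_lift A (a @ [hd p])" "A \<noteq> []" "last A = at_level j (hd p)"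
    using is_lift_lift[OF wa] last_lift[of "a @ [hd p]" 4] by (simp_all add: A_def j_def)
  have C: "is_lift C (last p # c)" "C \<noteq> []" "hd C = at_level k (last p)"
    using is_lift_lift[OF wc] hd_lift[of "last p # c" k] by (simp_all add: C_def)
  have whole: "is_lift (butlast A @ Z @ tl C) (a @ z @ c)"
    if Z: "is_lift Z z" "hd Z = at_level j (hd p)" "last Z = at_level k (last p)" "z \<noteq> []" "last z = last p"
    for Z z
  proof -
    have ne: "Z \<noteq> []" using Z by (auto simp: is_lift_def)
    have "is_lift (butlast Z @ C) (butlast z @ last p # c)"
      using is_lift_glue[OF Z(1) C(1) ne C(2)] Z(3) C(3) by simp
    moreover have "butlast z @ last p # c = z @ c"
      using append_butlast_last_id[OF Z(4)] Z(5) by (metis append_assoc append_Cons append_Nil)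
    moreover have "butlast Z @ C = Z @ tl C"
      using append_butlast_last_id[OF ne] Z(3) C(2,3) by (metis append_assoc append_Cons append_Nil hd_Cons_tl)
    ultimately have ZC: "is_lift (Z @ tl C) (z @ c)" by simp
    show ?thesis
      using is_lift_glue[OF A(1) ZC A(2)] ne A(3) Z(2) by simp
  qed
  have "short_walk helix_arcs P" "short_walk helix_arcs Q"
    using P(1) Q(1) pq(1,2) by (auto simp: is_lift_def short_walk_def)
  then have "elem_move helix_arcs (butlast A @ P @ tl C) (butlast A @ Q @ tl C)"
    using P Q by (intro elem_moveI) auto
  then show ?thesis using whole[OF P ne(1)] whole[OF Q ne(2)] pq(4) unfolding eq by auto
qed

lemma helix_arcs_Copy:
  "(Copy j u, Copy k v) \<in> helix_arcs \<longleftrightarrow>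
     (u, v) \<in> E \<and> part u \<noteq> None \<and> part v \<noteq> None \<and> (if part u = part v then j = k else j < k)"
  by (auto simp: helix_arcs_def)

text \<open>
  The first vertex of a lift can be raised if the second one lies on a level that is high enough or
  in the core, so the vertices behind it are raised first. This fails only for a second vertex in
  the same part, which has to be raised together with the first. Three consecutive vertices in one
  part can be contracted to two by transitivity, and two vertices with their neighbours on both
  sides form a piece of three arcs.
\<close>

lemma raise_level:
  assumes uj: "is_walk helix_arcs (u # Copy j v # Y)" and uk: "is_walk helix_arcs (u # Copy k v # Z)"
    and jk: "j < k" and proj: "map helix_proj Y = map helix_proj Z" and Y: "Y \<noteq> []"
    and base: "part (helix_proj (last Y)) = None"
    and IH: "\<And>u' Y' Z'. length Y' \<le> length Y \<Longrightarrow> is_walk helix_arcs (u' # Y') \<Longrightarrow>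
      is_walk helix_arcs (u' # Z') \<Longrightarrow> map helix_proj Y' = map helix_proj Z' \<Longrightarrow> Y' \<noteq> [] \<Longrightarrow>
      part (helix_proj (last Y')) = None \<Longrightarrow> homotopic helix_arcs (u' # Y') (u' # Z')"
  shows "homotopic helix_arcs (u # Copy j v # Y) (u # Copy k v # Z)"
proof -
  obtain y Y' z Z' where YZ: "Y = y # Y'" "Z = z # Z'" "helix_proj y = helix_proj z"
    "map helix_proj Y' = map helix_proj Z'"
    using Y proj by (cases Y; cases Z) auto
  have uv: "(u, Copy j v) \<in> helix_arcs" "(u, Copy k v) \<in> helix_arcs"
    and vy: "(Copy j v, y) \<in> helix_arcs" "(Copy k v, z) \<in> helix_arcs"
    and walks: "is_walk helix_arcs Y" "is_walk helix_arcs Z"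
    using uj uk by (simp_all add: YZ)
  have part_v: "part v \<noteq> None" using uv by (simp add: helix_arcs_def)
  show ?thesis
  proof (cases "(Copy j v, z) \<in> helix_arcs")
    case True
    \<comment> \<open>The second vertex is in the core or in the next part: raise the rest of the lift, then \<open>v\<close>.\<close>
    have "homotopic helix_arcs (Copy j v # Y) (Copy j v # Z)"
      using True walks vy proj Y base by (intro IH) (simp_all add: YZ)
    from homotopic_context[OF this, of "[u]" "[]"]
    have "homotopic helix_arcs (u # Copy j v # Y) (u # Copy j v # Z)" by simp
    moreover have "elem_move helix_arcs ([] @ [u, Copy j v, z] @ Z') ([] @ [u, Copy k v, z] @ Z')"
      using uv vy True by (intro elem_moveI) (auto simp: short_walk_def)
    ultimately show ?thesis by (simp add: YZ)
  next
    case False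
    obtain w where yz: "y = Copy j w" "z = Copy k w" and vw: "(v, w) \<in> E" "part v = part w"
    proof (cases z)
      case (Base w)
      then show ?thesis using False vy(2) part_v by (auto simp: helix_arcs_def)
    next
      case (Copy k' w)
      then have "(v, w) \<in> E" "part w \<noteq> None" using vy(2) by (auto simp: helix_arcs_Copy)
      then have "part v = part w" "k' = k"
        using False vy(2) jk part_v by (auto simp: Copy helix_arcs_Copy split: if_splits)
      moreover obtain j' where "y = Copy j' w"
        using YZ(3) vy(1) \<open>part w \<noteq> None\<close> by (cases y) (auto simp: Copy helix_arcs_def)
      moreover have "j' = j" using vy(1) calculation by (auto simp: helix_arcs_Copy)
      ultimately show ?thesis using that \<open>(v, w) \<in> E\<close> Copy by blast
    qed
    have "Y' \<noteq> []" using base part_v vw(2) by (auto simp: YZ yz)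
    then obtain y2 Y2 z2 Z2 where YZ': "Y' = y2 # Y2" "Z' = z2 # Z2" "helix_proj y2 = helix_proj z2"
      "map helix_proj Y2 = map helix_proj Z2"
      using YZ(4) by (cases Y'; cases Z') auto
    have wy: "(Copy j w, y2) \<in> helix_arcs" "(Copy k w, z2) \<in> helix_arcs"
      and walks2: "is_walk helix_arcs Y'" "is_walk helix_arcs Z'"
      using walks by (simp_all add: YZ YZ' yz)
    show ?thesis
    proof (cases "(Copy j w, z2) \<in> helix_arcs")
      case True
      \<comment> \<open>Only \<open>v\<close> and \<open>w\<close> lie in the same part: they are raised together.\<close>
      have "homotopic helix_arcs (Copy j w # Y') (Copy j w # Z')"
        using True walks2 wy YZ(4) \<open>Y' \<noteq> []\<close> base by (intro IH) (simp_all add: YZ YZ')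
      from homotopic_context[OF this, of "[u, Copy j v]" "[]"]
      have "homotopic helix_arcs (u # Copy j v # Y) (u # Copy j v # Copy j w # Z')"
        by (simp add: YZ yz)
      moreover have "elem_move helix_arcs ([] @ [u, Copy j v, Copy j w, z2] @ Z2)
          ([] @ [u, Copy k v, Copy k w, z2] @ Z2)"
        using uv vy True wy by (intro elem_moveI) (auto simp: short_walk_def yz)
      ultimately show ?thesis by (simp add: YZ YZ' yz)
    next
      case False
      obtain t where yz2: "y2 = Copy j t" "z2 = Copy k t" and wt: "(w, t) \<in> E" "part w = part t"
      proof (cases z2)
        case (Base t)
        then show ?thesis using False wy(2) part_v vw(2) by (auto simp: helix_arcs_def)
      next
        case (Copy k' t)
        then have "(w, t) \<in> E" "part t \<noteq> None" using wy(2) by (auto simp: helix_arcs_Copy)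
        then have "part w = part t" "k' = k"
          using False wy(2) jk part_v vw by (auto simp: Copy helix_arcs_Copy split: if_splits)
        moreover obtain j' where "y2 = Copy j' t"
          using YZ'(3) wy(1) \<open>part t \<noteq> None\<close> by (cases y2) (auto simp: Copy helix_arcs_def)
        moreover have "j' = j" using wy(1) calculation by (auto simp: helix_arcs_Copy)
        ultimately show ?thesis using that \<open>(w, t) \<in> E\<close> Copy by blast
      qed
      \<comment> \<open>Three vertices lie in the same part: drop the middle one from both lifts.\<close>
      have "(v, t) \<in> E" using part_trans[OF vw(1) wt(1) part_v vw(2) wt(2)] .
      then have vt: "(Copy l v, Copy l t) \<in> helix_arcs" for l
        using part_v vw(2) wt(2) by (simp add: helix_arcs_Copy)
      have contract: "homotopic helix_arcs (u # Copy l v # Copy l w # Copy l t # S)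
          (u # Copy l v # Copy l t # S)" if "(Copy l v, Copy l w) \<in> helix_arcs"
        "(Copy l w, Copy l t) \<in> helix_arcs" for l S
      proof -
        have "elem_move helix_arcs ([u] @ [Copy l v, Copy l w, Copy l t] @ S)
            ([u] @ [Copy l v, Copy l t] @ S)"
          using that vt by (intro elem_moveI) (auto simp: short_walk_def)
        then show ?thesis by simp
      qed
      have "homotopic helix_arcs (u # Copy j v # Y) (u # Copy j v # Y')"
        using contract[of j Y2] vy wy by (simp add: YZ YZ' yz yz2)
      also have "homotopic helix_arcs (u # Copy j v # Y') (u # Copy k v # Z')"
        using uv vt walks2 YZ(4) base by (intro IH) (simp_all add: YZ YZ' yz2)
      also have "homotopic helix_arcs (u # Copy k v # Z') (u # Copy k v # Z)"
        using homotopic_sym[OF contract[of k Z2]] vy wy by (simp add: YZ YZ' yz yz2)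
      finally show ?thesis .
    qed
  qed
qed

lemma lifts_homotopic_aux:
  assumes "is_walk helix_arcs (u # Y)" "is_walk helix_arcs (u # Z)"
    "map helix_proj Y = map helix_proj Z" "Y \<noteq> []" "part (helix_proj (last Y)) = None"
  shows "homotopic helix_arcs (u # Y) (u # Z)"
  using assms
proof (induction "length Y" arbitrary: u Y Z rule: less_induct)
  case less
  obtain y Y' z Z' where YZ: "Y = y # Y'" "Z = z # Z'" "helix_proj y = helix_proj z"
    "map helix_proj Y' = map helix_proj Z'"
    using less.prems(3,4) by (cases Y; cases Z) auto
  have uy: "(u, y) \<in> helix_arcs" "(u, z) \<in> helix_arcs"
    using less.prems by (simp_all add: YZ)
  show ?case
  proof (cases "y = z")
    case True
    have "homotopic helix_arcs (y # Y') (y # Z')"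
    proof (cases "Y' = []")
      case False
      then show ?thesis
        using less.prems True by (intro less.hyps) (simp_all add: YZ)
    qed (use YZ in simp)
    from homotopic_context[OF this, of "[u]" "[]"] show ?thesis by (simp add: YZ True)
  next
    case False
    obtain j k v where v: "y = Copy j v" "z = Copy k v" "part v \<noteq> None"
      using False YZ(3) uy by (cases y; cases z) (auto simp: helix_arcs_def)
    have "Y' \<noteq> []" using less.prems(5) v by (auto simp: YZ)
    then have Y': "Y' \<noteq> []" "Z' \<noteq> []" using YZ(4) by auto
    have last: "part (helix_proj (last Y')) = None" "part (helix_proj (last Z')) = None"
      using less.prems(5) Y' YZ(4) by (simp_all add: YZ flip: last_map)
    have len: "length Y' = length Z'" using YZ(4) map_eq_imp_length_eq by blast
    consider "j < k" | "k < j" using False v by force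
    then show ?thesis
    proof cases
      case 1
      have "homotopic helix_arcs (u # Copy j v # Y') (u # Copy k v # Z')"
        using less.prems 1 YZ(4) Y' last
        by (intro raise_level less.hyps) (simp_all add: YZ v)
      then show ?thesis by (simp add: YZ v)
    next
      case 2
      have "homotopic helix_arcs (u # Copy k v # Z') (u # Copy j v # Y')"
        using less.prems 2 YZ(4) Y' last len
        by (intro raise_level less.hyps) (simp_all add: YZ v)
      then show ?thesis using homotopic_sym by (simp add: YZ v)
    qed
  qed
qed

text \<open>
  Lifts with both ends in the core differ only in the levels of the vertices between, and the lower
  one can be raised to the other.
\<close>

lemma lifts_homotopic:
  assumes X: "is_lift X xs" and Y: "is_lift Y xs"
    and base: "part (hd xs) = None" "part (last xs) = None"
  shows "homotopic helix_arcs X Y"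
proof (cases xs)
  case (Cons d xs')
  have hd: "Z = Base d # tl Z" "map helix_proj (tl Z) = xs'" if "is_lift Z xs" for Z
    using that base(1) unfolding Cons is_lift_def
    by (cases Z; cases "hd Z"; auto)+
  obtain X' Y' where XY: "X = Base d # X'" "map helix_proj X' = xs'"
      "Y = Base d # Y'" "map helix_proj Y' = xs'"
    using hd[OF X] hd[OF Y] by metis
  show ?thesis
  proof (cases "X' = []")
    case False
    have "part (helix_proj (last X')) = None"
      using base(2) False last_map[OF False, of helix_proj] unfolding XY(2) Cons
      using XY(2) by auto
    then show ?thesis
      using X Y XY False unfolding XY(1,3) is_lift_def by (intro lifts_homotopic_aux) auto
  qed (use XY in auto)
qed (use X Y in \<open>auto simp: is_lift_def\<close>)

text \<open>
  Each elementary move lifts for some lifts of the two walks, and these may be exchanged for any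
  other lifts because lifts of one walk are homotopic.
\<close>

lemma homotopic_lift:
  assumes hom: "homotopic E xs ys" and walk: "is_walk E xs" and base: "part (hd xs) = None" "part (last xs) = None"
    and X: "is_lift X xs" and Y: "is_lift Y ys"
  shows "homotopic helix_arcs X Y"
  using hom Y
proof (induction arbitrary: Y rule: rtranclp_induct)
  case base
  then show ?case using lifts_homotopic[OF X base] assms(3,4) by simp
next
  case (step ys zs)
  have ys: "is_walk E ys" "part (hd ys) = None" and zs: "part (hd zs) = None" "part (last zs) = None"
    using homotopic_ends[OF step(1)] homotopic_ends[OF rtranclp.rtrancl_into_rtrancl[OF step(1,2)]]
      walk base by simp_all
  obtain Y' Z where "is_lift Y' ys" "is_lift Z zs" "elem_move helix_arcs Y' Z"
    using elem_move_lift[OF step(2) ys] by blast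
  then have "homotopic helix_arcs X Z"
    using step.IH by (meson rtranclp.rtrancl_into_rtrancl)
  also have "homotopic helix_arcs Z Y"
    using lifts_homotopic[OF \<open>is_lift Z zs\<close> step.prems zs] .
  finally show ?case .
qed

lemma fast_loop_at_lift:
  assumes "fast_loop_at N E x" and x: "part x = None"
  shows "fast_loop N helix_arcs"
proof -
  obtain b bs ts where *: "1 \<le> b" "closed_walk E x bs" "closed_walk E x ts"
    "homotopic E (laps (Suc b) bs @ [x]) (laps b ts @ [x])" "length bs < b * N"
    using assms(1) unfolding fast_loop_at_def by blast
  have lifts: "\<exists>cs'. is_lift (cs' @ [Base x]) (cs @ [x]) \<and> closed_walk helix_arcs (Base x) cs'"
    if cs: "closed_walk E x cs" for cs
  proof -
    let ?Y = "lift 0 (cs @ [x])"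
    have w: "is_walk E (cs @ [x])" "cs \<noteq> []" "hd cs = x" using cs by (auto simp: closed_walk_def)
    have last: "?Y = butlast ?Y @ [Base x]"
      using last_lift[of "cs @ [x]" 0] append_butlast_last_id[of ?Y] x by (simp add: at_level_def)
    have lift: "is_lift (butlast ?Y @ [Base x]) (cs @ [x])"
      using is_lift_lift[OF w(1), of 0] last by simp
    then have ne: "butlast ?Y \<noteq> []" using w(2) by (auto simp: is_lift_def)
    have "hd (butlast ?Y) = Base x"
      using hd_lift[of "cs @ [x]" 0] w x ne last by (metis at_level_def hd_append2 snoc_eq_iff_butlast)
    then show ?thesis using lift ne by (auto simp: closed_walk_def is_lift_def)
  qed
  obtain bs' where bs': "is_lift (bs' @ [Base x]) (bs @ [x])" "closed_walk helix_arcs (Base x) bs'"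
    using lifts[OF *(2)] by blast
  obtain ts' where ts': "is_lift (ts' @ [Base x]) (ts @ [x])" "closed_walk helix_arcs (Base x) ts'"
    using lifts[OF *(3)] by blast
  have laps: "is_lift (laps k cs' @ [Base x]) (laps k cs @ [x])"
    if "is_lift (cs' @ [Base x]) (cs @ [x])" "closed_walk helix_arcs (Base x) cs'" for k cs cs'
  proof -
    have "set (laps k cs') \<subseteq> set cs'" by (induction k) auto
    then show ?thesis
      using that(1) closed_walk_laps[OF that(2), of k] by (auto simp: is_lift_def map_laps)
  qed
  have "hd (laps (Suc b) bs @ [x]) = x"
    using *(2) by (intro hd_laps) (simp add: closed_walk_def)
  then have "homotopic helix_arcs (laps (Suc b) bs' @ [Base x]) (laps b ts' @ [Base x])"
    using x closed_walk_laps[OF *(2)]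
    by (intro homotopic_lift[OF *(4) _ _ _ laps[OF bs'] laps[OF ts']]) (simp_all del: laps_simps)
  moreover have "length bs' = length bs"
    using arg_cong[of "map helix_proj (bs' @ [Base x])" _ length] bs'(1) by (auto simp: is_lift_def)
  ultimately show ?thesis
    using *(1,5) bs'(2) ts'(2) unfolding fast_loop_def fast_loop_at_def by metis
qed

lemma fast_loop_helix:
  assumes "fast_loop N E" "N \<le> n"
  shows "fast_loop N helix_arcs"
proof -
  obtain x b bs ts where *: "1 \<le> b" "closed_walk E x bs" "closed_walk E x ts"
    "homotopic E (laps (Suc b) bs @ [x]) (laps b ts @ [x])" "length bs < b * N"
    using assms(1) unfolding fast_loop_def fast_loop_at_def by blast
  have "length bs < b * n" using *(5) assms(2) by (meson less_le_trans mult_le_mono2)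
  then obtain zs d where "homotopic E (laps (Suc b) bs @ [x]) zs" "d \<in> set zs" "part d = None"
    using fast_loop_meets_base[OF *(1-4)] by blast
  then show ?thesis using fast_loop_rebase[OF *] fast_loop_at_lift by blast
qed

end

section \<open>A fast loop on the circle\<close>

text \<open>
  Think of \<open>f\<close> as points on a circle, equally spaced and numbered counterclockwise. A long step is
  subdivided by inserting the points between one at a time.
\<close>

lemma arc_homotopic_unit_steps:
  assumes arc: "\<And>k s. 1 \<le> s \<Longrightarrow> s \<le> q \<Longrightarrow> (f k, f (k + s)) \<in> E"
    and "1 \<le> s" "s \<le> (q :: nat)"
  shows "homotopic E [f k, f (k + s)] (map f [k..<Suc (k + s)])"
  using assms(2,3)
proof (induction s rule: dec_induct)
  case base
  then show ?case by simp
next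
  case (step s)
  have "elem_move E ([] @ [f k, f (k + Suc s)] @ []) ([] @ [f k, f (k + s), f (k + Suc s)] @ [])"
    using arc[of "Suc s" k] arc[of s k] arc[of 1 "k + s"] step
    by (intro elem_moveI) (auto simp: short_walk_def)
  moreover have "homotopic E ([f k, f (k + s)] @ [f (k + Suc s)]) (map f [k..<Suc (k + s)] @ [f (k + Suc s)])"
    using homotopic_context[of E "[f k, f (k + s)]" "map f [k..<Suc (k + s)]" "[]"] step by simp
  ultimately show ?case by simp
qed

lemma steps_homotopic_unit_steps:
  assumes arc: "\<And>k s. 1 \<le> s \<Longrightarrow> s \<le> q \<Longrightarrow> (f k, f (k + s)) \<in> E"
    and s: "1 \<le> s" "s \<le> (q :: nat)"
  shows "homotopic E (map (\<lambda>i. f (i * s)) [0..<Suc k]) (map f [0..<Suc (k * s)])"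
proof (induction k)
  case (Suc k)
  have "homotopic E (map (\<lambda>i. f (i * s)) [0..<Suc k] @ [f (k * s + s)])
      (map f [0..<Suc (k * s)] @ [f (k * s + s)])"
    using homotopic_context[OF Suc, of "[]" "[f (k * s + s)]"] by simp
  also have "homotopic E \<dots> (map f [0..<k * s] @ map f [k * s..<Suc (k * s + s)])"
    using homotopic_context[OF arc_homotopic_unit_steps[OF arc s], of "map f [0..<k * s]" "k * s" "[]"]
    by simp
  also have "\<dots> = map f [0..<Suc (k * s + s)]"
    using upt_add_eq_append[of 0 "k * s" "Suc s"] by (simp del: upt_Suc flip: map_append)
  finally show ?case by (simp add: add.commute)
qed simp

lemma laps_periodic:
  assumes "\<And>i. g (i + l) = g i"
  shows "laps k (map g [0..<l]) @ [g 0] = map g [0..<Suc (k * l)]"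
proof -
  have "map g [0..<l + m] = map g [0..<l] @ map g [0..<m]" for m
  proof -
    have "map g [l..<l + m] = map g [0..<m]"
      using map_add_upt[of l m, symmetric] assms by (simp add: comp_def add.commute)
    then show ?thesis by (simp add: upt_add_eq_append[of 0 l m])
  qed
  then have "laps k (map g [0..<l]) = map g [0..<k * l]" for k
    by (induction k) simp_all
  moreover have "g (k * l) = g 0"
    using assms[of "_ * l"] by (induction k) (simp_all add: add.commute)
  ultimately show ?thesis by simp
qed

text \<open>
  Both loops live on one grid of \<open>N * (b * N - 1)\<close> points: \<open>b * N - 1\<close> steps of \<open>b * N\<close> points go
  round \<open>b\<close> times, and \<open>(b + 1) * N\<close> steps of \<open>b * N - 1\<close> points go round \<open>b + 1\<close> times.
  After \<open>b + 1\<close> and \<open>b\<close> laps, respectively, both have made \<open>b * (b + 1)\<close> turns, and both are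
  homotopic to the walk that visits every grid point.
\<close>

lemma fast_loop_grid:
  fixes f :: "nat \<Rightarrow> 'a"
  assumes b: "1 \<le> b" and N: "2 \<le> N" and per: "\<And>k. f (k + N * (b * N - 1)) = f k"
    and arc: "\<And>k s. 1 \<le> s \<Longrightarrow> s \<le> b * N \<Longrightarrow> (f k, f (k + s)) \<in> E"
  shows "fast_loop N E"
proof -
  define p where "p = N * (b * N - 1)"
  have bN: "2 \<le> b * N" using b N by (metis mult_le_mono mult_1)
  have per': "f (k + j * p) = f k" for k j
  proof (induction j)
    case (Suc j)
    have "k + Suc j * p = (k + j * p) + p" by simp
    then show ?case using per[of "k + j * p"] Suc by (simp only: flip: p_def)
  qed simp
  define g where "g i = f (i * (b * N))" for i
  define h where "h i = f (i * (b * N - 1))" for i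
  let ?l = "b * N - 1" and ?m = "Suc b * N"
  have pg: "g (i + ?l) = g i" for i
  proof -
    have "(i + l) * (b * N) = i * (b * N) + b * (N * l)" for l by (simp add: algebra_simps)
    then show ?thesis using per'[of "i * (b * N)" b] by (simp only: g_def p_def)
  qed
  have ph: "h (i + ?m) = h i" for i
  proof -
    have "(i + ?m) * l = i * l + Suc b * (N * l)" for l by (simp add: algebra_simps)
    then show ?thesis using per'[of "i * (b * N - 1)" "Suc b"] by (simp only: h_def p_def)
  qed
  have walk: "is_walk E (map (\<lambda>i. f (i * s)) [0..<Suc k])" if "1 \<le> s" "s \<le> b * N" for s k
  proof -
    have "(f k, f (s + k)) \<in> E" for k using arc[OF that, of k] by (simp add: add.commute)
    then show ?thesis by (auto simp: is_walk_def successively_conv_nth simp del: upt_Suc)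
  qed
  have base: "g 0 = f 0" "h 0 = f 0" by (simp_all add: g_def h_def)
  have "closed_walk E (f 0) (map g [0..<?l])"
  proof -
    have "map g [0..<?l] @ [f 0] = map g [0..<Suc ?l]"
      using laps_periodic[of g ?l 1, OF pg] base by (simp del: upt_Suc)
    moreover have "is_walk E (map g [0..<Suc ?l])"
      unfolding g_def using b N by (intro walk) auto
    ultimately show ?thesis using bN base by (simp add: closed_walk_def hd_map del: upt_Suc)
  qed
  moreover have "closed_walk E (f 0) (map h [0..<?m])"
  proof -
    have "map h [0..<?m] @ [f 0] = map h [0..<Suc ?m]"
      using laps_periodic[of h ?m 1, OF ph] base by (simp del: upt_Suc)
    moreover have "is_walk E (map h [0..<Suc ?m])"
      unfolding h_def using bN by (intro walk) auto
    ultimately show ?thesis using bN N base by (simp add: closed_walk_def hd_map del: upt_Suc)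
  qed
  moreover have "homotopic E (laps (Suc b) (map g [0..<?l]) @ [f 0]) (laps b (map h [0..<?m]) @ [f 0])"
  proof -
    have "homotopic E (map g [0..<Suc (Suc b * ?l)]) (map f [0..<Suc (Suc b * ?l * (b * N))])"
      unfolding g_def using bN b N by (intro steps_homotopic_unit_steps[OF arc]) auto
    moreover have "homotopic E (map h [0..<Suc (b * ?m)]) (map f [0..<Suc (b * ?m * ?l)])"
      unfolding h_def using bN b N by (intro steps_homotopic_unit_steps[OF arc]) auto
    moreover have "Suc b * ?l * (b * N) = b * ?m * ?l" by (simp only: mult_ac)
    ultimately have "homotopic E (map g [0..<Suc (Suc b * ?l)]) (map h [0..<Suc (b * ?m)])"
      using homotopic_sym by (metis rtranclp_trans)
    then show ?thesis
      using base laps_periodic[of g ?l "Suc b", OF pg] laps_periodic[of h ?m b, OF ph] by metis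
  qed
  moreover have "length (map g [0..<?l]) < b * N" using bN by simp
  ultimately show ?thesis using b unfolding fast_loop_def fast_loop_at_def by blast
qed

lemma cis_neq_1:
  assumes "0 < t" "t < 2 * pi"
  shows "cis t \<noteq> 1"
proof
  assume "cis t = 1"
  then obtain m :: int where m: "t = real_of_int m * 2 * pi"
    using cos_one_2pi_int[of t] by (auto simp: complex_eq_iff)
  then have "0 < real_of_int m" "real_of_int m < 1"
    using assms by (simp_all add: zero_less_mult_iff)
  then show False by simp
qed

lemma fast_loop_circle:
  assumes r: "3 < r" "r < real N"
  shows "fast_loop N (parcs (circle_graph r))"
proof -
  \<comment> \<open>Going round \<open>b\<close> times in \<open>b * N - 1\<close> equal steps requires \<open>b * r \<le> b * N - 1\<close>.\<close>
  obtain b :: nat where b: "1 < real b * (real N - r)"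
    using reals_Archimedean3[of "real N - r"] r by auto
  have b1: "1 \<le> b" using b by (cases b) auto
  have N: "4 \<le> N" using r by linarith
  define p where "p = N * (b * N - 1)"
  define f where "f k = cis (2 * pi * real k / real p)" for k
  have bN: "1 \<le> b * N" using b1 N by simp
  have real_p: "real p = real N * (real b * real N - 1)"
    using bN by (simp add: p_def of_nat_diff)
  have p_ge: "real (b * N) * r \<le> real p"
    unfolding real_p using b N mult_left_mono[of "real b * r" "real b * real N - 1" "real N"]
    by (simp add: algebra_simps)
  have "0 < real (b * N) * r" using bN r by (intro mult_pos_pos) (simp_all flip: of_nat_mult)
  then have p0: "0 < real p" using p_ge by linarith
  show ?thesis
  proof (rule fast_loop_grid[OF b1, of N f])
    show "f (k + N * (b * N - 1)) = f k" for k
      using p0 unfolding p_def[symmetric] f_def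
      by (simp add: add_divide_distrib distrib_left flip: cis_mult)
    fix k s :: nat
    assume s: "1 \<le> s" "s \<le> b * N"
    define t where "t = 2 * pi * real s / real p"
    have "real s * r \<le> real p"
    proof -
      have "real s \<le> real (b * N)" using s(2) by (simp only: of_nat_le_iff)
      then have "real s * r \<le> real (b * N) * r" using r by (intro mult_right_mono) auto
      then show ?thesis using p_ge by linarith
    qed
    then have t: "0 < t" "t \<le> 2 * pi / r"
      using s r p0 by (auto simp: t_def field_simps)
    moreover have "2 * pi / r < 2 * pi" using r by (simp add: field_simps)
    ultimately have "cis t \<noteq> 1" by (intro cis_neq_1) auto
    moreover have "f (k + s) = f k * cis t"
      by (simp add: f_def t_def cis_mult add_divide_distrib distrib_left)
    moreover have "f k \<noteq> 0" "f k \<in> sphere 0 1" "f (k + s) \<in> sphere 0 1" by (simp_all add: f_def)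
    ultimately show "(f k, f (k + s)) \<in> parcs (circle_graph r)"
      using t by (auto simp: circle_graph_def intro!: exI[of _ t])
  qed (use N in simp)
qed

section \<open>The class of digraphs without fast loops\<close>

definition loop_bounded :: "nat \<Rightarrow> nat pair_pre_digraph set" where
  "loop_bounded N = {A. pair_digraph A \<and> \<not> fast_loop N (parcs A)}"

lemma digraph_iso_fast_loop:
  fixes A :: "'a pair_pre_digraph" and B :: "'b pair_pre_digraph"
  assumes "pair_wf_digraph A" "pair_wf_digraph B" "digraph_iso (with_proj A) (with_proj B)"
  shows "fast_loop N (parcs A) \<longleftrightarrow> fast_loop N (parcs B)"
proof -
  interpret A: pair_wf_digraph A by fact
  interpret B: pair_wf_digraph B by fact
  obtain h where h: "bij_betw h (pverts A) (pverts B)"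
    "\<And>u v. u \<in> pverts A \<Longrightarrow> v \<in> pverts A \<Longrightarrow> (u, v) \<in> parcs A \<longleftrightarrow> (h u, h v) \<in> parcs B"
    using assms(3) unfolding pair_digraph_iso_iff[OF assms(1,2)] by blast
  let ?k = "inv_into (pverts A) h"
  have "(h u, h v) \<in> parcs B" if "(u, v) \<in> parcs A" for u v
    using that h(2) A.in_arcsD1 A.in_arcsD2 by blast
  moreover have "(?k u, ?k v) \<in> parcs A" if uv: "(u, v) \<in> parcs B" for u v
  proof -
    have "u \<in> pverts B" "v \<in> pverts B" using uv B.in_arcsD1 B.in_arcsD2 by blast+
    then have "?k u \<in> pverts A" "?k v \<in> pverts A" "h (?k u) = u" "h (?k v) = v"
      using h(1) by (auto simp: bij_betw_def inv_into_into f_inv_into_f)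
    then show ?thesis using h(2) uv by metis
  qed
  ultimately show ?thesis using fast_loop_map by metis
qed

lemma pair_digraph_iso:
  fixes A B :: "nat pair_pre_digraph"
  assumes A: "pair_digraph A" and iso: "digraph_iso (with_proj A) (with_proj B)"
  shows "pair_digraph B"
proof -
  interpret A: pair_digraph A by fact
  obtain f where f: "pre_digraph.digraph_isomorphism (with_proj A) f" "with_proj B = app_iso f (with_proj A)"
    using iso unfolding digraph_iso_def by blast
  have "wf_digraph (with_proj B)" unfolding f(2) using f(1) by (rule A.wf_digraphI_app_iso)
  then have wf: "pair_wf_digraph B" by (simp add: wf_digraph_wp_iff)
  then interpret B: pair_wf_digraph B .
  have "finite (pverts B)" "finite (parcs B)"
    using arg_cong[OF f(2), of verts] arg_cong[OF f(2), of arcs] A.pair_finite_verts A.pair_finite_arcs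
    by simp_all
  moreover have "fst e \<noteq> snd e" if "e \<in> parcs B" for e
  proof
    assume "fst e = snd e"
    then obtain v where v: "e = (v, v)" by (cases e) auto
    obtain h where h: "bij_betw h (pverts A) (pverts B)"
      "\<And>u v. u \<in> pverts A \<Longrightarrow> v \<in> pverts A \<Longrightarrow> (u, v) \<in> parcs A \<longleftrightarrow> (h u, h v) \<in> parcs B"
      using iso unfolding pair_digraph_iso_iff[OF A.pair_wf_digraph_axioms wf] by blast
    have "v \<in> pverts B" using that v B.in_arcsD1 by blast
    then obtain u where "u \<in> pverts A" "v = h u" using h(1) by (auto simp: bij_betw_def)
    then show False using h(2) that v A.pair_no_loops by fastforce
  qed
  ultimately show ?thesis by unfold_locales auto
qed

lemma hereditary_loop_bounded: "hereditary_class (loop_bounded N)"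
  unfolding hereditary_class_def
proof (intro conjI ballI allI impI)
  fix A assume "A \<in> loop_bounded N"
  then show "pair_digraph A" by (simp add: loop_bounded_def)
next
  fix A B :: "nat pair_pre_digraph"
  assume A: "A \<in> loop_bounded N" and iso: "digraph_iso (with_proj A) (with_proj B)"
  have "pair_digraph A" using A by (simp add: loop_bounded_def)
  then have "pair_digraph B" using iso by (rule pair_digraph_iso)
  moreover have "fast_loop N (parcs A) \<longleftrightarrow> fast_loop N (parcs B)"
    using \<open>pair_digraph A\<close> \<open>pair_digraph B\<close> iso
    by (intro digraph_iso_fast_loop) (auto simp: pair_digraph_def pair_fin_digraph_def)
  ultimately show "B \<in> loop_bounded N" using A by (simp add: loop_bounded_def)
next
  fix A B :: "nat pair_pre_digraph"
  assume A: "A \<in> loop_bounded N" and ind: "induced_subgraph (with_proj B) (with_proj A)"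
  interpret A: pair_digraph A using A by (simp add: loop_bounded_def)
  have sub: "pverts B \<subseteq> pverts A" "parcs B \<subseteq> parcs A" "wf_digraph (with_proj B)"
    using ind by (auto simp: induced_subgraph_def subgraph_def)
  then interpret B: pair_wf_digraph B by (simp add: wf_digraph_wp_iff)
  have "pair_digraph B"
    using sub A.pair_finite_verts A.pair_finite_arcs A.pair_no_loops
    by unfold_locales (auto intro: finite_subset)
  moreover have "\<not> fast_loop N (parcs B)"
    using A sub(2) fast_loop_map[of N "parcs B" id "parcs A"] by (auto simp: loop_bounded_def)
  ultimately show "B \<in> loop_bounded N" by (simp add: loop_bounded_def)
qed

lemma weak_embeddings_loop_bounded: "closed_under_weak_embeddings (loop_bounded N)"
  using fast_loop_map[of N]
  unfolding closed_under_weak_embeddings_def loop_bounded_def weak_embedding_def by fast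

text \<open>
  A fast loop uses finitely many arcs, and their ends induce a finite subgraph that has it as well.
\<close>

lemma belongs_to_loop_bounded:
  fixes M :: "'a pair_pre_digraph"
  assumes M: "pair_wf_digraph M" and belongs: "belongs_to M (loop_bounded N)"
  shows "\<not> fast_loop N (parcs M)"
proof
  interpret M: pair_wf_digraph M by fact
  assume "fast_loop N (parcs M)"
  then obtain F where F: "finite F" "F \<subseteq> parcs M" "fast_loop N F" by (rule fast_loop_finite)
  define V where "V = fst ` F \<union> snd ` F"
  define A where "A = \<lparr>pverts = V, parcs = parcs M \<inter> V \<times> V\<rparr>"
  have A: "pair_wf_digraph A" by unfold_locales (auto simp: A_def)
  have "V \<subseteq> pverts M" using F(2) M.in_arcsD1 M.in_arcsD2 by (force simp: V_def)
  then have "induced_subgraph (with_proj A) (with_proj M)"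
    unfolding induced_subgraph_def subgraph_def wf_digraph_wp_iff
    using A M by (auto simp: A_def compatible_def)
  moreover have "finite (pverts A)" using F(1) by (simp add: A_def V_def)
  ultimately obtain B where B: "B \<in> loop_bounded N" "digraph_iso (with_proj A) (with_proj B)"
    using belongs unfolding belongs_to_def by blast
  have "pair_wf_digraph B"
    using B(1) by (simp add: loop_bounded_def pair_digraph_def pair_fin_digraph_def)
  then have "\<not> fast_loop N (parcs A)"
    using digraph_iso_fast_loop[OF A _ B(2)] B(1) by (auto simp: loop_bounded_def)
  moreover have "F \<subseteq> parcs A" using F(2) by (force simp: A_def V_def)
  ultimately show False using F(3) fast_loop_map[of N F id "parcs A"] by auto
qed

text \<open>
  Walks are strictly increasing, so there are no closed ones.
\<close>

lemma omega_belongs_to_loop_bounded: "belongs_to omega_graph (loop_bounded N)"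
  unfolding belongs_to_def
proof (intro allI impI)
  fix A :: "nat pair_pre_digraph"
  assume A: "induced_subgraph (with_proj A) (with_proj omega_graph) \<and> finite (pverts A)"
  then have arcs: "parcs A \<subseteq> {(i, j). i < j}" and "wf_digraph (with_proj A)"
    by (auto simp: induced_subgraph_def subgraph_def omega_graph_def)
  then interpret A: pair_wf_digraph A by (simp add: wf_digraph_wp_iff)
  have "parcs A \<subseteq> pverts A \<times> pverts A" using A.in_arcsD1 A.in_arcsD2 by auto
  then have "finite (parcs A)" using A finite_subset by blast
  then have digraph: "pair_digraph A" using A arcs by unfold_locales auto
  have "\<not> closed_walk (parcs A) x bs" for x bs
  proof
    assume bs: "closed_walk (parcs A) x bs"
    then have "successively (<) (bs @ [x])"
      using arcs unfolding closed_walk_def is_walk_def by (auto elim: successively_mono)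
    then have "sorted_wrt (<) (bs @ [x])" by (simp add: successively_iff_sorted_wrt_strong)
    then show False using bs by (auto simp: closed_walk_def sorted_wrt_append)
  qed
  then have "A \<in> loop_bounded N"
    using digraph by (auto simp: loop_bounded_def fast_loop_def fast_loop_at_def)
  moreover have "digraph_iso (with_proj A) (with_proj A)"
    unfolding pair_digraph_iso_iff[OF A.pair_wf_digraph_axioms A.pair_wf_digraph_axioms]
    by (intro exI[of _ id]) auto
  ultimately show "\<exists>B \<in> loop_bounded N. digraph_iso (with_proj A) (with_proj B)" by blast
qed

definition part_of :: "nat \<Rightarrow> (nat \<Rightarrow> 'a set) \<Rightarrow> 'a \<Rightarrow> nat option" where
  "part_of n P v = (if \<exists>i<n. v \<in> P i then Some (SOME i. i < n \<and> v \<in> P i) else None)"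

lemma part_of_None: "part_of n P v = None \<longleftrightarrow> (\<forall>i<n. v \<notin> P i)"
  by (simp add: part_of_def)

lemma part_of_Some:
  assumes "disjoint_family_on P {..<n}"
  shows "part_of n P v = Some i \<longleftrightarrow> i < n \<and> v \<in> P i"
proof -
  have "i = j" if "i < n" "j < n" "v \<in> P i" "v \<in> P j" for i j
    using assms that unfolding disjoint_family_on_def by blast
  then show ?thesis
    unfolding part_of_def by (auto intro: some_equality someI2)
qed

lemma cyclic_parts_decomposition:
  assumes dec: "cyclic_decomposition n G P D" and dir: "directed_decomposition n G P"
    and int: "interval_parts n G P" and n: "4 \<le> n"
  shows "cyclic_parts (parcs G) (part_of n P) n"
proof
  have disj: "disjoint_family_on P {..<n}" "\<And>i. i < n \<Longrightarrow> P i \<inter> D = {}"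
    and edge: "\<And>u v. (u, v) \<in> parcs G \<Longrightarrow> \<exists>i<n. {u, v} \<subseteq> P i \<union> P ((i + 1) mod n) \<union> D"
    and G: "pair_digraph G"
    using dec unfolding cyclic_decomposition_def by auto
  interpret G: pair_digraph G by fact
  note part = part_of_Some[OF disj(1)]
  show "4 \<le> n" by fact
  show "i < n" if "part_of n P u = Some i" for u i using that part by blast
  show "(u, u) \<notin> parcs G" for u using G.pair_no_loops[of "(u, u)"] by auto
  show "k = i \<or> k = Suc i mod n"
    if uv: "(u, v) \<in> parcs G" "part_of n P u = Some i" "part_of n P v = Some k" for u v i k
  proof -
    obtain l where l: "l < n" "{u, v} \<subseteq> P l \<union> P (Suc l mod n) \<union> D"
      using edge[OF uv(1)] by auto
    have l': "Suc l mod n < n" using n by simp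
    have u: "i < n" "u \<in> P i" and v: "k < n" "v \<in> P k" using uv part by auto
    have "part_of n P u = Some l \<or> part_of n P u = Some (Suc l mod n)"
      "part_of n P v = Some l \<or> part_of n P v = Some (Suc l mod n)"
      using l l' u v disj(2)[of i] disj(2)[of k] part by auto
    moreover have "\<not> (v \<in> P l \<and> u \<in> P (Suc l mod n))"
      using dir that(1) l(1) unfolding directed_decomposition_def by auto
    ultimately show ?thesis using that(2,3) u v by auto
  qed
  show "(u, w) \<in> parcs G"
    if uvw: "(u, v) \<in> parcs G" "(v, w) \<in> parcs G" "part_of n P u \<noteq> None"
      "part_of n P u = part_of n P v" "part_of n P v = part_of n P w" for u v w
  proof -
    obtain i where i: "i < n" "u \<in> P i" "v \<in> P i" "w \<in> P i"
      using uvw(3-5) part by (metis option.exhaust)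
    obtain m :: nat and S where S: "P i = (\<Union>j<m. S j)"
      "\<forall>j<m. strict_linear_order_on (S j) (Restr (parcs G) (S j))"
      "\<forall>j<m. \<forall>j'<m. j \<noteq> j' \<longrightarrow> parcs G \<inter> S j \<times> S j' = {}"
      using int i(1) unfolding interval_parts_def by metis
    obtain j j' j'' where j: "j < m" "u \<in> S j" "j' < m" "v \<in> S j'" "j'' < m" "w \<in> S j''"
      using i S(1) by auto
    have "j = j'" "j' = j''" using S(3) j that(1,2) by blast+
    then have "(u, v) \<in> Restr (parcs G) (S j)" "(v, w) \<in> Restr (parcs G) (S j)"
      using j that(1,2) by auto
    moreover have "trans (Restr (parcs G) (S j))"
      using S(2) j(1) by (simp add: strict_linear_order_on_def)
    ultimately show ?thesis by (meson IntD1 transD)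
  qed
qed

text \<open>
  The lifted fast loop lives on \<open>helix_arcs\<close>; the inclusion transports it to any helix of the
  decomposition.
\<close>

lemma helix_arcs_helix:
  assumes dec: "cyclic_decomposition n G P D" and dir: "directed_decomposition n G P"
    and parts: "cyclic_parts (parcs G) (part_of n P) n" and helix: "is_helix n G P D H"
  shows "cyclic_parts.helix_arcs (parcs G) (part_of n P) \<subseteq> parcs H"
proof
  interpret cyclic_parts "parcs G" "part_of n P" n by fact
  have disj: "disjoint_family_on P {..<n}" and verts: "pverts G = (\<Union>i<n. P i) \<union> D"
    and G: "pair_digraph G" and n: "3 \<le> n"
    using dec unfolding cyclic_decomposition_def by auto
  interpret G: pair_digraph G by fact
  note part = part_of_Some[OF disj]
  have H: "pair_wf_digraph H" using helix by (simp add: is_helix_def pair_loopfree_digraph_def)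
  have arcI: "(x, y) \<in> parcs H"
    if "(helix_proj x, helix_proj y) \<in> parcs G" "i < n" "j < j'"
      "x \<in> helix_segment n P D i j j'" "y \<in> helix_segment n P D i j j'" for x y i j j'
    using helix that unfolding is_helix_def iso_by_pair_iff[OF H G.pair_wf_digraph_axioms] by blast
  have base: "v \<in> D" if "v \<in> pverts G" "part_of n P v = None" for v
    using that verts part_of_None[of n P v] by auto
  fix e assume "e \<in> helix_arcs"
  then obtain x y where e: "e = (x, y)" and xy: "(helix_proj x, helix_proj y) \<in> parcs G"
    "on_helix x" "on_helix y" "climbs x y"
    by (auto simp: helix_arcs_def)
  have v: "helix_proj x \<in> pverts G" "helix_proj y \<in> pverts G"
    using G.in_arcsD1[OF xy(1)] G.in_arcsD2[OF xy(1)] by auto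
  have copy: "\<exists>i<n. v \<in> P i" if "part_of n P v \<noteq> None" for v
    using that part_of_None by metis
  have "\<exists>i<n. \<exists>j j'. j < j' \<and> {x, y} \<subseteq> helix_segment n P D i j j'"
  proof (cases x)
    case (Base u)
    show ?thesis
    proof (cases y)
      case (Base w)
      then show ?thesis using \<open>x = Base u\<close> base v xy n
        by (intro exI[of _ 0] conjI exI[of _ "0 :: nat"] exI[of _ "1 :: nat"]) (auto simp: helix_segment_def)
    next
      case (Copy k w)
      then obtain i where "i < n" "w \<in> P i" using xy copy by auto
      then show ?thesis using Copy Base base v xy
        by (intro exI[of _ i] conjI exI[of _ k] exI[of _ "Suc k"]) (auto simp: helix_segment_def)
    qed
  next
    case (Copy j u)
    then obtain i where i: "i < n" "u \<in> P i" using xy copy by auto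
    show ?thesis
    proof (cases y)
      case (Base w)
      then show ?thesis using Copy base v xy i
        by (intro exI[of _ i] conjI exI[of _ j] exI[of _ "Suc j"]) (auto simp: helix_segment_def)
    next
      case (Copy k w)
      then obtain l where l: "l < n" "w \<in> P l" using xy copy by auto
      have pu: "part_of n P u = Some i" and pw: "part_of n P w = Some l" using i l part by auto
      have "l = i \<or> l = Suc i mod n" using part_arc[OF _ pu pw] xy(1) Copy \<open>x = Copy j u\<close> by simp
      then show ?thesis
      proof (cases "l = i")
        case True
        then have "k = j" using xy(4) Copy \<open>x = Copy j u\<close> pu pw by simp
        then show ?thesis using Copy \<open>x = Copy j u\<close> i l True
          by (intro exI[of _ i] conjI exI[of _ j] exI[of _ "Suc j"]) (auto simp: helix_segment_def)
      next
        case False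
        then have "l = Suc i mod n" using \<open>l = i \<or> l = Suc i mod n\<close> by simp
        moreover have "j < k" using False xy(4) Copy \<open>x = Copy j u\<close> pu pw by simp
        ultimately show ?thesis using Copy \<open>x = Copy j u\<close> i l
          by (intro exI[of _ i] conjI exI[of _ j] exI[of _ k]) (auto simp: helix_segment_def)
      qed
    qed
  qed
  then show "e \<in> parcs H" using arcI xy(1) e by auto
qed

lemma interval_helix_maps_loop_bounded:
  assumes "4 \<le> N" "N \<le> n"
  shows "closed_under_interval_helix_maps n (loop_bounded N)"
  unfolding closed_under_interval_helix_maps_def
proof (intro allI impI)
  fix G :: "nat pair_pre_digraph" and H h
  assume "interval_helix_map n h H G \<and> belongs_to H (loop_bounded N)"
  then obtain P D where dec: "cyclic_decomposition n G P D" and dir: "directed_decomposition n G P"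
    and int: "interval_parts n G P" and helix: "is_helix n G P D H"
    and belongs: "belongs_to H (loop_bounded N)"
    unfolding interval_helix_map_def by blast
  have parts: "cyclic_parts (parcs G) (part_of n P) n"
    using dec dir int assms by (intro cyclic_parts_decomposition) auto
  interpret cyclic_parts "parcs G" "part_of n P" n by fact
  have "pair_wf_digraph H" using helix by (simp add: is_helix_def pair_loopfree_digraph_def)
  then have "\<not> fast_loop N (parcs H)" using belongs by (rule belongs_to_loop_bounded)
  then have "\<not> fast_loop N helix_arcs"
    using helix_arcs_helix[OF dec dir parts helix] fast_loop_map[of N helix_arcs id "parcs H"] by auto
  then have "\<not> fast_loop N (parcs G)" using fast_loop_helix assms(2) by blast
  then show "G \<in> loop_bounded N"
    using dec by (simp add: loop_bounded_def cyclic_decomposition_def)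
qed

theorem theorem4p6:
  fixes r :: real
  assumes "r > 3" and "r \<notin> \<int>"
  shows "\<exists>\<H> :: nat pair_pre_digraph set.
           hereditary_class \<H> \<and>
           closed_under_weak_embeddings \<H> \<and>
           belongs_to omega_graph \<H> \<and>
           \<not> belongs_to (circle_graph r) \<H> \<and>
           (\<forall>n :: nat. real n > r \<longrightarrow> closed_under_interval_helix_maps n \<H>)"
proof -
  define N where "N = nat \<lceil>r\<rceil>"
  have "r \<noteq> of_int \<lceil>r\<rceil>" using assms(2) Ints_of_int by metis
  then have "r < of_int \<lceil>r\<rceil>" using le_of_int_ceiling[of r] by linarith
  then have N: "r < real N" using assms(1) by (simp add: N_def)
  have "\<not> belongs_to (circle_graph r) (loop_bounded N)"
    using belongs_to_loop_bounded[of "circle_graph r" N] fast_loop_circle[OF assms(1) N]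
      loopfree_circle_graph[of r] by (auto simp: pair_loopfree_digraph_def)
  moreover have "closed_under_interval_helix_maps n (loop_bounded N)" if "r < real n" for n
  proof (rule interval_helix_maps_loop_bounded)
    show "4 \<le> N" using assms(1) N by simp
    show "N \<le> n" using that by (simp add: N_def ceiling_le_iff)
  qed
  ultimately show ?thesis
    using hereditary_loop_bounded weak_embeddings_loop_bounded omega_belongs_to_loop_bounded
    by blast
qed

end
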